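(* Let $(M,\varphi,\xi,\eta,g,\varepsilon)$ be a $3$-dimensional $(\varepsilon)$-para Sasakian manifold with $\eta$-parallel Ricci tensor. Then the scalar curvature $r$ of $M$ is constant.
   Context: All manifolds and tensor fields are smooth; $\mathfrak X(M)$ denotes the vector fields on $M$. An almost paracontact structure $(\varphi,\xi,\eta)$ on $M$ consists of a $(1,1)$-tensor field $\varphi$, a vector field $\xi$ and a $1$-form $\eta$ with $\varphi^2=I-\eta\otimes\xi$, $\eta(\xi)=1$, $\varphi\xi=0$, $\eta\circ\varphi=0$. A semi-Riemannian metric is a non-degenerate symmetric $(0,2)$-tensor field (of some constant index, arbitrary). If $g$ is a semi-Riemannian metric on $M$ with $g(\varphi X,\varphi Y)=g(X,Y)-\varepsilon\eta(X)\eta(Y)$ for all $X,Y\in\mathfrak X(M)$, where $\varepsilon\in\{1,-1\}$ is a constant, then $(M,\varphi,\xi,\eta,g,\varepsilon)$ is an $(\varepsilon)$-almost paracontact metric manifold. It is an $(\varepsilon)$-para Sasakian manifold if moreover $(\nabla_X\varphi)Y=-g(\varphi X,\varphi Y)\xi-\varepsilon\eta(Y)\varphi^2X$ for all $X,Y\in\mathfrak X(M)$, where $\nabla$ is the Levi-Civita connection of $g$. Curvature conventions: $R(X,Y)Z=\nabla_X\nabla_YZ-\nabla_Y\nabla_XZ-\nabla_{[X,Y]}Z$, the Ricci tensor is $S(Y,Z)=\mathrm{trace}(X\mapsto R(X,Y)Z)$, the Ricci operator $Q$ is defined by $g(QX,Y)=S(X,Y)$, and $r=\mathrm{trace}\,Q$.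 The Ricci tensor $S$ is $\eta$-parallel if $(\nabla_XS)(\varphi Y,\varphi Z)=0$ for all $X,Y,Z\in\mathfrak X(M)$.
   Formalization: The scalar curvature is shown to be constant on every connected subset of M, hence constant when M is connected; connectedness is not stated in the text, and without it the claim fails (disjoint union of hyperbolic 3-space, r = -6, and Sol, r = -2). *)

theory Defs
  imports "HOL-Analysis.Analysis"
begin

text \<open>Only meaningful for open \<open>S\<close>. Since the domain is finite-dimensional, differentiability
  together with \<open>C\<^sup>k\<close> directional derivatives is the usual \<open>C\<^sup>k\<^sup>+\<^sup>1\<close> condition.\<close>

primrec Ck_on :: "nat \<Rightarrow> 'a::euclidean_space set \<Rightarrow> ('a \<Rightarrow> 'b::real_normed_vector) \<Rightarrow> bool" where
  "Ck_on 0 S f \<longleftrightarrow> continuous_on S f"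
| "Ck_on (Suc k) S f \<longleftrightarrow> (\<forall>x\<in>S. f differentiable (at x)) \<and>
     (\<forall>v. Ck_on k S (\<lambda>x. frechet_derivative f (at x) v))"

definition smooth_on :: "'a::euclidean_space set \<Rightarrow> ('a \<Rightarrow> 'b::real_normed_vector) \<Rightarrow> bool" where
  "smooth_on S f \<longleftrightarrow> (\<forall>k. Ck_on k S f)"

text \<open>The manifold is the whole type \<open>'m\<close>, required to be Hausdorff and second countable
  by its sort, with an atlas modelled on \<open>real ^ 'n\<close>. The atlas need not be maximal.
  A chart consists of its domain and of the coordinate map. Connectedness is not part of
  the notion of a manifold; constancy of a function is a statement on connected sets.\<close>

type_synonym ('m, 'n) chart = "'m set \<times> ('m \<Rightarrow> (real, 'n) vec)"

definition chart_inv :: "('m, 'n) chart \<Rightarrow> (real, 'n) vec \<Rightarrow> 'm" where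
  "chart_inv c = inv_into (fst c) (snd c)"

definition smooth_atlas ::
  "('m::{t2_space, second_countable_topology}, 'n::finite) chart set \<Rightarrow> bool" where
  "smooth_atlas A \<longleftrightarrow>
     (\<Union>c\<in>A. fst c) = UNIV \<and>
     (\<forall>c\<in>A. open (fst c) \<and> open (snd c ` fst c) \<and>
        homeomorphism (fst c) (snd c ` fst c) (snd c) (chart_inv c)) \<and>
     (\<forall>c\<in>A. \<forall>d\<in>A. smooth_on (snd c ` (fst c \<inter> fst d)) (snd d \<circ> chart_inv c))"

definition smooth_fun :: "('m, 'n::finite) chart set \<Rightarrow> ('m \<Rightarrow> real) \<Rightarrow> bool" where
  "smooth_fun A f \<longleftrightarrow> (\<forall>c\<in>A. smooth_on (snd c ` fst c) (f \<circ> chart_inv c))"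

text \<open>The tangent space at \<open>p\<close> is represented by \<open>real ^ 'n\<close> by means of the coordinates
  of a chart around \<open>p\<close> that is chosen once and for all. As the chosen chart varies with \<open>p\<close>, the
  components of a smooth section, viewed as a function of \<open>p\<close>, need not even be continuous.
  Smoothness is therefore never stated for these components, but through the derivatives
  of smooth functions.\<close>

definition chart_at :: "('m, 'n) chart set \<Rightarrow> 'm \<Rightarrow> ('m, 'n) chart" where
  "chart_at A p = (SOME c. c \<in> A \<and> p \<in> fst c)"

definition deriv_at ::
  "('m, 'n::finite) chart set \<Rightarrow> 'm \<Rightarrow> real ^ 'n \<Rightarrow> ('m \<Rightarrow> 'b::real_normed_vector) \<Rightarrow> 'b" where
  "deriv_at A p v f =
     frechet_derivative (f \<circ> chart_inv (chart_at A p)) (at (snd (chart_at A p) p)) v"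

definition deriv_along ::
  "('m, 'n::finite) chart set \<Rightarrow> ('m \<Rightarrow> real ^ 'n) \<Rightarrow> ('m \<Rightarrow> real) \<Rightarrow> 'm \<Rightarrow> real" where
  "deriv_along A X f = (\<lambda>p. deriv_at A p (X p) f)"

definition vector_fields :: "('m, 'n::finite) chart set \<Rightarrow> ('m \<Rightarrow> real ^ 'n) set" where
  "vector_fields A = {X. \<forall>f. smooth_fun A f \<longrightarrow> smooth_fun A (deriv_along A X f)}"

text \<open>The components of \<open>X\<close> in a chart \<open>c\<close> are the derivatives of the coordinates of \<open>c\<close> along \<open>X\<close>;
  only meaningful on the image of \<open>c\<close>.\<close>

definition in_chart ::
  "('m, 'n::finite) chart set \<Rightarrow> ('m, 'n) chart \<Rightarrow> ('m \<Rightarrow> real ^ 'n) \<Rightarrow> real ^ 'n \<Rightarrow> real ^ 'n" where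
  "in_chart A c X x = deriv_at A (chart_inv c x) (X (chart_inv c x)) (snd c)"

text \<open>The coordinate formula \<open>[X, Y]\<^sup>i = X\<^sup>j \<partial>\<^sub>j Y\<^sup>i - Y\<^sup>j \<partial>\<^sub>j X\<^sup>i\<close>, evaluated at \<open>p\<close> in the chart
  that identifies the tangent space at \<open>p\<close> with \<open>real ^ 'n\<close>.\<close>

definition lie_bracket ::
  "('m, 'n::finite) chart set \<Rightarrow> ('m \<Rightarrow> real ^ 'n) \<Rightarrow> ('m \<Rightarrow> real ^ 'n) \<Rightarrow> 'm \<Rightarrow> real ^ 'n" where
  "lie_bracket A X Y p =
     (let c = chart_at A p; x = snd c p in
       frechet_derivative (in_chart A c Y) (at x) (X p) -
       frechet_derivative (in_chart A c X) (at x) (Y p))"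

definition one_form :: "('m, 'n::finite) chart set \<Rightarrow> ('m \<Rightarrow> real ^ 'n \<Rightarrow> real) \<Rightarrow> bool" where
  "one_form A \<eta> \<longleftrightarrow> (\<forall>p. linear (\<eta> p)) \<and>
     (\<forall>X\<in>vector_fields A. smooth_fun A (\<lambda>p. \<eta> p (X p)))"

definition tensor_1_1 ::
  "('m, 'n::finite) chart set \<Rightarrow> ('m \<Rightarrow> real ^ 'n \<Rightarrow> real ^ 'n) \<Rightarrow> bool" where
  "tensor_1_1 A \<phi> \<longleftrightarrow> (\<forall>p. linear (\<phi> p)) \<and>
     (\<forall>X\<in>vector_fields A. (\<lambda>p. \<phi> p (X p)) \<in> vector_fields A)"

definition tensor_0_2 ::
  "('m, 'n::finite) chart set \<Rightarrow> ('m \<Rightarrow> real ^ 'n \<Rightarrow> real ^ 'n \<Rightarrow> real) \<Rightarrow> bool" where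
  "tensor_0_2 A b \<longleftrightarrow> (\<forall>p. bilinear (b p)) \<and>
     (\<forall>X\<in>vector_fields A. \<forall>Y\<in>vector_fields A. smooth_fun A (\<lambda>p. b p (X p) (Y p)))"

definition index :: "(real ^ 'n::finite \<Rightarrow> real ^ 'n \<Rightarrow> real) \<Rightarrow> nat" where
  "index b = Max {dim V |V. subspace V \<and> (\<forall>v\<in>V. v \<noteq> 0 \<longrightarrow> b v v < 0)}"

definition semi_riemannian_metric ::
  "('m, 'n::finite) chart set \<Rightarrow> ('m \<Rightarrow> real ^ 'n \<Rightarrow> real ^ 'n \<Rightarrow> real) \<Rightarrow> bool" where
  "semi_riemannian_metric A g \<longleftrightarrow>
     tensor_0_2 A g \<and>
     (\<forall>p u v. g p u v = g p v u) \<and>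
     (\<forall>p u. (\<forall>v. g p u v = 0) \<longrightarrow> u = 0) \<and>
     (\<exists>\<nu>. \<forall>p. index (g p) = \<nu>)"

text \<open>A connection is a total function on all sections, constrained only on smooth vector fields.\<close>

definition connection ::
  "('m, 'n::finite) chart set \<Rightarrow> (('m \<Rightarrow> real ^ 'n) \<Rightarrow> ('m \<Rightarrow> real ^ 'n) \<Rightarrow> ('m \<Rightarrow> real ^ 'n)) \<Rightarrow> bool" where
  "connection A nabla \<longleftrightarrow>
     (\<forall>X\<in>vector_fields A. \<forall>Y\<in>vector_fields A.
        nabla X Y \<in> vector_fields A \<and>
        (\<forall>Z\<in>vector_fields A.
           nabla (\<lambda>p. X p + Y p) Z = (\<lambda>p. nabla X Z p + nabla Y Z p) \<and>
           nabla X (\<lambda>p. Y p + Z p) = (\<lambda>p. nabla X Y p + nabla X Z p)) \<and>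
        (\<forall>f. smooth_fun A f \<longrightarrow>
           nabla (\<lambda>p. f p *\<^sub>R X p) Y = (\<lambda>p. f p *\<^sub>R nabla X Y p) \<and>
           nabla X (\<lambda>p. f p *\<^sub>R Y p) = (\<lambda>p. deriv_along A X f p *\<^sub>R Y p + f p *\<^sub>R nabla X Y p)))"

definition levi_civita ::
  "('m, 'n::finite) chart set \<Rightarrow> ('m \<Rightarrow> real ^ 'n \<Rightarrow> real ^ 'n \<Rightarrow> real) \<Rightarrow>
   (('m \<Rightarrow> real ^ 'n) \<Rightarrow> ('m \<Rightarrow> real ^ 'n) \<Rightarrow> ('m \<Rightarrow> real ^ 'n)) \<Rightarrow> bool" where
  "levi_civita A g nabla \<longleftrightarrow>
     connection A nabla \<and>
     (\<forall>X\<in>vector_fields A. \<forall>Y\<in>vector_fields A. \<forall>p.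
        nabla X Y p - nabla Y X p = lie_bracket A X Y p) \<and>
     (\<forall>X\<in>vector_fields A. \<forall>Y\<in>vector_fields A. \<forall>Z\<in>vector_fields A. \<forall>p.
        deriv_along A X (\<lambda>q. g q (Y q) (Z q)) p =
          g p (nabla X Y p) (Z p) + g p (Y p) (nabla X Z p))"

definition curvature ::
  "('m, 'n::finite) chart set \<Rightarrow> (('m \<Rightarrow> real ^ 'n) \<Rightarrow> ('m \<Rightarrow> real ^ 'n) \<Rightarrow> ('m \<Rightarrow> real ^ 'n)) \<Rightarrow>
   ('m \<Rightarrow> real ^ 'n) \<Rightarrow> ('m \<Rightarrow> real ^ 'n) \<Rightarrow> ('m \<Rightarrow> real ^ 'n) \<Rightarrow> 'm \<Rightarrow> real ^ 'n" where
  "curvature A nabla X Y Z p =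
     nabla X (nabla Y Z) p - nabla Y (nabla X Z) p - nabla (lie_bracket A X Y) Z p"

text \<open>The curvature is defined on vector fields; by tensoriality its value at \<open>p\<close> only depends on
  the values of the fields at \<open>p\<close>, so tangent vectors are extended to arbitrary vector fields.\<close>

definition extend_vec :: "('m, 'n::finite) chart set \<Rightarrow> 'm \<Rightarrow> real ^ 'n \<Rightarrow> 'm \<Rightarrow> real ^ 'n" where
  "extend_vec A p v = (SOME X. X \<in> vector_fields A \<and> X p = v)"

definition curvature_at ::
  "('m, 'n::finite) chart set \<Rightarrow> (('m \<Rightarrow> real ^ 'n) \<Rightarrow> ('m \<Rightarrow> real ^ 'n) \<Rightarrow> ('m \<Rightarrow> real ^ 'n)) \<Rightarrow>
   'm \<Rightarrow> real ^ 'n \<Rightarrow> real ^ 'n \<Rightarrow> real ^ 'n \<Rightarrow> real ^ 'n" where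
  "curvature_at A nabla p u v w =
     curvature A nabla (extend_vec A p u) (extend_vec A p v) (extend_vec A p w) p"

definition ricci ::
  "('m, 'n::finite) chart set \<Rightarrow> (('m \<Rightarrow> real ^ 'n) \<Rightarrow> ('m \<Rightarrow> real ^ 'n) \<Rightarrow> ('m \<Rightarrow> real ^ 'n)) \<Rightarrow>
   'm \<Rightarrow> real ^ 'n \<Rightarrow> real ^ 'n \<Rightarrow> real" where
  "ricci A nabla p v w = trace (matrix (\<lambda>u. curvature_at A nabla p u v w))"

definition ricci_op ::
  "('m, 'n::finite) chart set \<Rightarrow> ('m \<Rightarrow> real ^ 'n \<Rightarrow> real ^ 'n \<Rightarrow> real) \<Rightarrow>
   (('m \<Rightarrow> real ^ 'n) \<Rightarrow> ('m \<Rightarrow> real ^ 'n) \<Rightarrow> ('m \<Rightarrow> real ^ 'n)) \<Rightarrow> 'm \<Rightarrow> real ^ 'n \<Rightarrow> real ^ 'n" where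
  "ricci_op A g nabla p u = (THE w. \<forall>v. g p w v = ricci A nabla p u v)"

definition scalar_curvature ::
  "('m, 'n::finite) chart set \<Rightarrow> ('m \<Rightarrow> real ^ 'n \<Rightarrow> real ^ 'n \<Rightarrow> real) \<Rightarrow>
   (('m \<Rightarrow> real ^ 'n) \<Rightarrow> ('m \<Rightarrow> real ^ 'n) \<Rightarrow> ('m \<Rightarrow> real ^ 'n)) \<Rightarrow> 'm \<Rightarrow> real" where
  "scalar_curvature A g nabla p = trace (matrix (ricci_op A g nabla p))"

definition cov_deriv_0_2 ::
  "('m, 'n::finite) chart set \<Rightarrow> (('m \<Rightarrow> real ^ 'n) \<Rightarrow> ('m \<Rightarrow> real ^ 'n) \<Rightarrow> ('m \<Rightarrow> real ^ 'n)) \<Rightarrow>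
   ('m \<Rightarrow> real ^ 'n \<Rightarrow> real ^ 'n \<Rightarrow> real) \<Rightarrow>
   ('m \<Rightarrow> real ^ 'n) \<Rightarrow> ('m \<Rightarrow> real ^ 'n) \<Rightarrow> ('m \<Rightarrow> real ^ 'n) \<Rightarrow> 'm \<Rightarrow> real" where
  "cov_deriv_0_2 A nabla b X Y Z p =
     deriv_along A X (\<lambda>q. b q (Y q) (Z q)) p - b p (nabla X Y p) (Z p) - b p (Y p) (nabla X Z p)"

definition cov_deriv_1_1 ::
  "(('m \<Rightarrow> real ^ 'n::finite) \<Rightarrow> ('m \<Rightarrow> real ^ 'n) \<Rightarrow> ('m \<Rightarrow> real ^ 'n)) \<Rightarrow>
   ('m \<Rightarrow> real ^ 'n \<Rightarrow> real ^ 'n) \<Rightarrow> ('m \<Rightarrow> real ^ 'n) \<Rightarrow> ('m \<Rightarrow> real ^ 'n) \<Rightarrow> 'm \<Rightarrow> real ^ 'n" where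
  "cov_deriv_1_1 nabla \<phi> X Y p = nabla X (\<lambda>q. \<phi> q (Y q)) p - \<phi> p (nabla X Y p)"

definition almost_paracontact ::
  "('m, 'n::finite) chart set \<Rightarrow> ('m \<Rightarrow> real ^ 'n \<Rightarrow> real ^ 'n) \<Rightarrow> ('m \<Rightarrow> real ^ 'n) \<Rightarrow>
   ('m \<Rightarrow> real ^ 'n \<Rightarrow> real) \<Rightarrow> bool" where
  "almost_paracontact A \<phi> \<xi> \<eta> \<longleftrightarrow>
     tensor_1_1 A \<phi> \<and> \<xi> \<in> vector_fields A \<and> one_form A \<eta> \<and>
     (\<forall>p v. \<phi> p (\<phi> p v) = v - \<eta> p v *\<^sub>R \<xi> p) \<and>
     (\<forall>p. \<eta> p (\<xi> p) = 1) \<and>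
     (\<forall>p. \<phi> p (\<xi> p) = 0) \<and>
     (\<forall>p v. \<eta> p (\<phi> p v) = 0)"

definition eps_almost_paracontact_metric ::
  "('m, 'n::finite) chart set \<Rightarrow> ('m \<Rightarrow> real ^ 'n \<Rightarrow> real ^ 'n) \<Rightarrow> ('m \<Rightarrow> real ^ 'n) \<Rightarrow>
   ('m \<Rightarrow> real ^ 'n \<Rightarrow> real) \<Rightarrow> ('m \<Rightarrow> real ^ 'n \<Rightarrow> real ^ 'n \<Rightarrow> real) \<Rightarrow> real \<Rightarrow> bool" where
  "eps_almost_paracontact_metric A \<phi> \<xi> \<eta> g \<epsilon> \<longleftrightarrow>
     almost_paracontact A \<phi> \<xi> \<eta> \<and> semi_riemannian_metric A g \<and> \<epsilon> \<in> {1, -1} \<and>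
     (\<forall>X\<in>vector_fields A. \<forall>Y\<in>vector_fields A. \<forall>p.
        g p (\<phi> p (X p)) (\<phi> p (Y p)) = g p (X p) (Y p) - \<epsilon> * \<eta> p (X p) * \<eta> p (Y p))"

definition eps_para_sasakian ::
  "('m, 'n::finite) chart set \<Rightarrow> ('m \<Rightarrow> real ^ 'n \<Rightarrow> real ^ 'n) \<Rightarrow> ('m \<Rightarrow> real ^ 'n) \<Rightarrow>
   ('m \<Rightarrow> real ^ 'n \<Rightarrow> real) \<Rightarrow> ('m \<Rightarrow> real ^ 'n \<Rightarrow> real ^ 'n \<Rightarrow> real) \<Rightarrow> real \<Rightarrow>
   (('m \<Rightarrow> real ^ 'n) \<Rightarrow> ('m \<Rightarrow> real ^ 'n) \<Rightarrow> ('m \<Rightarrow> real ^ 'n)) \<Rightarrow> bool" where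
  "eps_para_sasakian A \<phi> \<xi> \<eta> g \<epsilon> nabla \<longleftrightarrow>
     eps_almost_paracontact_metric A \<phi> \<xi> \<eta> g \<epsilon> \<and> levi_civita A g nabla \<and>
     (\<forall>X\<in>vector_fields A. \<forall>Y\<in>vector_fields A. \<forall>p.
        cov_deriv_1_1 nabla \<phi> X Y p =
          - g p (\<phi> p (X p)) (\<phi> p (Y p)) *\<^sub>R \<xi> p - (\<epsilon> * \<eta> p (Y p)) *\<^sub>R \<phi> p (\<phi> p (X p)))"

definition eta_parallel_ricci ::
  "('m, 'n::finite) chart set \<Rightarrow> ('m \<Rightarrow> real ^ 'n \<Rightarrow> real ^ 'n) \<Rightarrow>
   (('m \<Rightarrow> real ^ 'n) \<Rightarrow> ('m \<Rightarrow> real ^ 'n) \<Rightarrow> ('m \<Rightarrow> real ^ 'n)) \<Rightarrow> bool" where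
  "eta_parallel_ricci A \<phi> nabla \<longleftrightarrow>
     (\<forall>X\<in>vector_fields A. \<forall>Y\<in>vector_fields A. \<forall>Z\<in>vector_fields A. \<forall>p.
        cov_deriv_0_2 A nabla (ricci A nabla) X (\<lambda>q. \<phi> q (Y q)) (\<lambda>q. \<phi> q (Z q)) p = 0)"

end

theory Submission
  imports Defs "HOL-Real_Asymp.Real_Asymp"
begin

text \<open>Since \<open>\<nabla>\<^sub>X \<xi> = \<epsilon> \<phi> X\<close>, the para Sasakian condition gives \<open>R(X, Y)\<xi> = \<eta>(X)Y - \<eta>(Y)X\<close>. The kernel of
  \<open>\<eta>\<close> is 2-dimensional, so that on it the curvature is a single number and \<open>S = (r/2 + \<epsilon>) g\<close>.
  Take \<open>e \<in> ker \<eta>\<close> with \<open>g(e, e) \<noteq> 0\<close>, extended to a field \<open>E\<close> in \<open>ker \<eta>\<close>, and \<open>X\<close> with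
  \<open>g(e, \<phi> X) = 0\<close>. Then \<open>\<eta>(\<nabla>\<^sub>X E) = - g(e, \<phi> X) = 0\<close>, so \<open>\<nabla>\<^sub>X E\<close> also lies in \<open>ker \<eta>\<close>, and
  \<open>(\<nabla>\<^sub>X S)(E, E) = 0\<close> reduces to \<open>X(r) g(e, e) = 0\<close>. Such \<open>X\<close> span the tangent space: for an
  orthogonal basis \<open>e\<^sub>1, e\<^sub>2\<close> of \<open>ker \<eta>\<close>, they include \<open>\<xi>\<close>, \<open>\<phi> e\<^sub>1\<close> (with \<open>e = e\<^sub>2\<close>) and \<open>\<phi> e\<^sub>2\<close>
  (with \<open>e = e\<^sub>1\<close>). Hence \<open>dr = 0\<close>. The choice of \<open>X\<close> orthogonal to \<open>\<phi> e\<close> makes the mixed components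
  \<open>S(\<xi>, \<cdot>)\<close>, and with them the Bianchi identity, unnecessary.\<close>

section \<open>Functions of class \<open>C\<^sup>k\<close>\<close>

lemma Ck_on_has_derivative:
  "Ck_on (Suc k) S f \<Longrightarrow> x \<in> S \<Longrightarrow> (f has_derivative frechet_derivative f (at x)) (at x)"
  by (simp add: frechet_derivative_works)

lemma Ck_on_SucD: "Ck_on (Suc k) S f \<Longrightarrow> Ck_on k S f"
proof (induction k arbitrary: f)
  case 0
  then show ?case
    by (auto intro!: continuous_at_imp_continuous_on differentiable_imp_continuous_within)
next
  case (Suc k)
  then show ?case by (metis Ck_on.simps(2))
qed

text \<open>Because \<open>S\<close> is open, the full derivative at a point of \<open>S\<close>
  sees only the values of the function on \<open>S\<close>.\<close>

lemma Ck_on_cong: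
  assumes "open S" "Ck_on k S f" "\<And>x. x \<in> S \<Longrightarrow> f x = g x"
  shows "Ck_on k S g"
  using assms(2,3)
proof (induction k arbitrary: f g)
  case 0
  then show ?case by (metis Ck_on.simps(1) continuous_on_cong)
next
  case (Suc k)
  have d: "(g has_derivative frechet_derivative f (at x)) (at x)" if "x \<in> S" for x
    using has_derivative_transform_within_open[OF Ck_on_has_derivative[OF Suc.prems(1) that]
        \<open>open S\<close> that] Suc.prems(2) by auto
  then have "frechet_derivative g (at x) = frechet_derivative f (at x)" if "x \<in> S" for x
    using that frechet_derivative_at by metis
  then have "Ck_on k S (\<lambda>x. frechet_derivative g (at x) v)" for v
    using Suc.IH[of "\<lambda>x. frechet_derivative f (at x) v" "\<lambda>x. frechet_derivative g (at x) v"]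
      Suc.prems(1) by simp
  then show ?case using d by (auto simp: differentiable_def)
qed

text \<open>By uniqueness of derivatives, an explicit \<open>f'\<close> may replace the choice
  operator \<open>frechet_derivative\<close>. The closure properties below go through this
  rule.\<close>

lemma Ck_on_SucI:
  assumes "open S" "\<And>x. x \<in> S \<Longrightarrow> (f has_derivative f' x) (at x)" "\<And>v. Ck_on k S (\<lambda>x. f' x v)"
  shows "Ck_on (Suc k) S f"
proof -
  have "Ck_on k S (\<lambda>x. frechet_derivative f (at x) v)" for v
    by (rule Ck_on_cong[OF assms(1) assms(3)]) (simp add: frechet_derivative_at[OF assms(2)])
  then show ?thesis using assms(2) by (auto simp: differentiable_def)
qed

lemma Ck_on_Union:
  "(\<And>S. S \<in> \<S> \<Longrightarrow> open S) \<Longrightarrow> (\<And>S. S \<in> \<S> \<Longrightarrow> Ck_on k S f) \<Longrightarrow> Ck_on k (\<Union>\<S>) f"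
proof (induction k arbitrary: f)
  case 0
  then show ?case using continuous_on_open_Union by (metis Ck_on.simps(1))
qed auto

lemma Ck_on_const: "open S \<Longrightarrow> Ck_on k S (\<lambda>x. c)"
proof (induction k arbitrary: c)
  case (Suc k)
  show ?case
    by (rule Ck_on_SucI[where f' = "\<lambda>x v. 0"]) (use Suc in auto)
qed auto

lemma Ck_on_bounded_linear_compose:
  assumes "open S" "bounded_linear h" "Ck_on k S f"
  shows "Ck_on k S (\<lambda>x. h (f x))"
  using assms(3)
proof (induction k arbitrary: f)
  case 0
  then show ?case using assms(2) by (simp add: bounded_linear.continuous_on)
next
  case (Suc k)
  show ?case
  proof (rule Ck_on_SucI[OF \<open>open S\<close>])
    show "((\<lambda>x. h (f x)) has_derivative (\<lambda>v. h (frechet_derivative f (at x) v))) (at x)" if "x \<in> S" for x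
      using Ck_on_has_derivative[OF Suc.prems that] bounded_linear.has_derivative[OF assms(2)] by blast
    show "Ck_on k S (\<lambda>x. h (frechet_derivative f (at x) v))" for v
      using Suc by simp
  qed
qed

lemma Ck_on_add:
  assumes "open S" "Ck_on k S f" "Ck_on k S g"
  shows "Ck_on k S (\<lambda>x. f x + g x)"
  using assms(2,3)
proof (induction k arbitrary: f g)
  case 0
  then show ?case by (simp add: continuous_on_add)
next
  case (Suc k)
  show ?case
  proof (rule Ck_on_SucI[OF \<open>open S\<close>])
    show "((\<lambda>x. f x + g x) has_derivative
      (\<lambda>v. frechet_derivative f (at x) v + frechet_derivative g (at x) v)) (at x)" if "x \<in> S" for x
      using Suc.prems that by (auto intro!: has_derivative_add Ck_on_has_derivative)
    show "Ck_on k S (\<lambda>x. frechet_derivative f (at x) v + frechet_derivative g (at x) v)" for v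
      using Suc by simp
  qed
qed

lemma Ck_on_scaleR:
  fixes f :: "_ \<Rightarrow> real"
  assumes "open S" "Ck_on k S f" "Ck_on k S g"
  shows "Ck_on k S (\<lambda>x. f x *\<^sub>R g x)"
  using assms(2,3)
proof (induction k arbitrary: f g)
  case 0
  then show ?case by (simp add: continuous_on_scaleR)
next
  case (Suc k)
  show ?case
  proof (rule Ck_on_SucI[OF \<open>open S\<close>])
    show "((\<lambda>x. f x *\<^sub>R g x) has_derivative
      (\<lambda>v. f x *\<^sub>R frechet_derivative g (at x) v + frechet_derivative f (at x) v *\<^sub>R g x)) (at x)"
      if "x \<in> S" for x
      using Suc.prems that by (intro has_derivative_scaleR Ck_on_has_derivative)
    show "Ck_on k S (\<lambda>x. f x *\<^sub>R frechet_derivative g (at x) v + frechet_derivative f (at x) v *\<^sub>R g x)" for v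
      using Suc.prems Suc.prems[THEN Ck_on_SucD] by (intro Ck_on_add Suc.IH \<open>open S\<close>) auto
  qed
qed

lemma Ck_on_sum:
  assumes "open S" "\<And>i. i \<in> I \<Longrightarrow> Ck_on k S (f i)"
  shows "Ck_on k S (\<lambda>x. \<Sum>i\<in>I. f i x)"
  using assms(2)
  by (induction I rule: infinite_finite_induct) (auto intro!: Ck_on_const Ck_on_add \<open>open S\<close>)

lemma linear_Basis_expand:
  fixes v :: "'a::euclidean_space"
  assumes "linear l"
  shows "l v = (\<Sum>b\<in>Basis. (v \<bullet> b) *\<^sub>R l b)"
proof -
  have "l v = l (\<Sum>b\<in>Basis. (v \<bullet> b) *\<^sub>R b)" by (simp add: euclidean_representation)
  then show ?thesis using assms by (simp add: linear_sum linear_cmul)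
qed

text \<open>The chain rule applies the derivative of \<open>g\<close> to the moving vector Df(x) v,
  whereas \<open>Ck_on\<close> speaks of fixed directions only. Expanding this vector in
  \<open>Basis\<close> leaves a sum of products, each with a factor of class C^k by
  induction.\<close>

lemma Ck_on_compose:
  fixes f :: "'a::euclidean_space \<Rightarrow> 'b::euclidean_space"
  assumes "open S" "Ck_on k S f" "Ck_on k T g" "f ` S \<subseteq> T"
  shows "Ck_on k S (g \<circ> f)"
  using assms(2,3)
proof (induction k arbitrary: g)
  case 0
  then show ?case using assms(4) by (auto intro!: continuous_on_compose intro: continuous_on_subset simp del: o_apply)
next
  case (Suc k)
  define g' where "g' b x = frechet_derivative g (at x) b" for b x
  show ?case
  proof (rule Ck_on_SucI[OF \<open>open S\<close>])
    fix x assume x: "x \<in> S"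
    have dg: "(g has_derivative (\<lambda>v. g' v (f x))) (at (f x))"
      unfolding g'_def using Ck_on_has_derivative[OF Suc.prems(2)] x assms(4) by auto
    have eq: "(\<lambda>v. g' v (f x)) = (\<lambda>v. \<Sum>b\<in>Basis. (v \<bullet> b) *\<^sub>R g' b (f x))"
      by (rule ext) (rule linear_Basis_expand[OF has_derivative_linear[OF dg]])
    have "(g has_derivative (\<lambda>v. \<Sum>b\<in>Basis. (v \<bullet> b) *\<^sub>R g' b (f x))) (at (f x))"
      by (subst eq[symmetric]) (rule dg)
    from diff_chain_at[OF Ck_on_has_derivative[OF Suc.prems(1) x] this]
    show "(g \<circ> f has_derivative
        (\<lambda>v. \<Sum>b\<in>Basis. (frechet_derivative f (at x) v \<bullet> b) *\<^sub>R (g' b \<circ> f) x)) (at x)"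
      by (simp only: o_def)
  next
    have "Ck_on k S (g' b \<circ> f)" for b
      unfolding g'_def by (rule Suc.IH) (use Suc.prems in \<open>auto intro: Ck_on_SucD\<close>)
    moreover have "Ck_on k S (\<lambda>x. frechet_derivative f (at x) v \<bullet> b)" for v b
      using Suc.prems(1) by (intro Ck_on_bounded_linear_compose[OF \<open>open S\<close> bounded_linear_inner_left]) simp
    ultimately show "Ck_on k S (\<lambda>x. \<Sum>b\<in>Basis. (frechet_derivative f (at x) v \<bullet> b) *\<^sub>R (g' b \<circ> f) x)" for v
      by (intro Ck_on_sum Ck_on_scaleR \<open>open S\<close>)
  qed
qed

lemma Ck_on_id: "open S \<Longrightarrow> Ck_on k S (\<lambda>x. x)"
proof (cases k)
  case (Suc n)
  then show "open S \<Longrightarrow> ?thesis"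
    by (auto intro!: Ck_on_SucI[where f' = "\<lambda>x v. v"] Ck_on_const simp del: Ck_on.simps)
qed auto

text \<open>The family is closed under differentiation up to linear combinations, which makes the
  smoothness of its member \<open>k = 0\<close> provable by induction.\<close>

definition exp_bump :: "nat \<Rightarrow> real \<Rightarrow> real" where
  "exp_bump k t = (if t \<le> 0 then 0 else exp (- 1 / t) / t ^ k)"

text \<open>The formula also covers t = 0, where both sides vanish because exp(-1/t) decays faster
  than every power of t.\<close>

lemma exp_bump_has_derivative:
  "(exp_bump k has_real_derivative (exp_bump (k + 2) t - k * exp_bump (k + 1) t)) (at t)"
proof (cases t "0::real" rule: linorder_cases)
  case less
  have "((\<lambda>_. 0) has_real_derivative 0) (at t)" by simp
  then have "(exp_bump k has_real_derivative 0) (at t)"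
    by (rule has_field_derivative_transform_within_open[of _ _ _ "{..<0}"])
      (use less in \<open>auto simp: exp_bump_def\<close>)
  then show ?thesis using less by (simp add: exp_bump_def)
next
  case equal
  have l: "((\<lambda>h. (exp_bump k (0 + h) - exp_bump k 0) / h) \<longlongrightarrow> 0) (at_left 0)"
    by (rule tendsto_eventually) (auto simp: exp_bump_def eventually_at_filter)
  \<comment> \<open>This is the difference quotient at 0 from the right; dividing by h raises the
    exponent to \<open>Suc k\<close>.\<close>
  have "((\<lambda>h::real. exp (- 1 / h) / h ^ Suc k) \<longlongrightarrow> 0) (at_right 0)"
    by real_asymp
  then have r: "((\<lambda>h. (exp_bump k (0 + h) - exp_bump k 0) / h) \<longlongrightarrow> 0) (at_right 0)"
    by (rule Lim_transform_eventually) (auto simp: exp_bump_def eventually_at_filter field_simps)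
  have "(exp_bump k has_real_derivative 0) (at 0)"
    using filterlim_split_at[OF l r] by (simp add: DERIV_def)
  then show ?thesis using equal by (simp add: exp_bump_def)
next
  case greater
  have "((\<lambda>t. exp (- 1 / t) / t ^ k) has_real_derivative
      (exp (- 1 / t) / t ^ (k + 2) - k * (exp (- 1 / t) / t ^ (k + 1)))) (at t)"
    \<comment> \<open>The rule for \<open>t ^ k\<close> produces the exponent k - 1 with truncated
      subtraction, hence the case split on \<open>k\<close>.\<close>
    using greater by (auto intro!: derivative_eq_intros simp: field_simps power2_eq_square)
      (cases k; simp add: field_simps)
  then have "(exp_bump k has_real_derivative
      (exp (- 1 / t) / t ^ (k + 2) - k * (exp (- 1 / t) / t ^ (k + 1)))) (at t)"
    by (rule has_field_derivative_transform_within_open[of _ _ _ "{0<..}"])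
      (use greater in \<open>auto simp: exp_bump_def\<close>)
  then show ?thesis using greater by (simp add: exp_bump_def)
qed

lemma Ck_on_exp_bump: "Ck_on n UNIV (exp_bump k)"
proof (induction n arbitrary: k)
  case 0
  have "isCont (exp_bump k) t" for t
    using exp_bump_has_derivative[of k t] DERIV_isCont by blast
  then show ?case by (simp add: continuous_at_imp_continuous_on)
next
  case (Suc n)
  show ?case
  proof (rule Ck_on_SucI)
    show "(exp_bump k has_derivative (*) (exp_bump (k + 2) t + (- real k) *\<^sub>R exp_bump (k + 1) t)) (at t)" for t
      using exp_bump_has_derivative[of k t] by (simp add: has_field_derivative_def)
    have "Ck_on n UNIV (\<lambda>t. v *\<^sub>R (exp_bump (k + 2) t + (- real k) *\<^sub>R exp_bump (k + 1) t))" for v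
      by (intro Ck_on_scaleR Ck_on_add Ck_on_const Suc.IH) auto
    then show "Ck_on n UNIV (\<lambda>t. (exp_bump (k + 2) t + (- real k) *\<^sub>R exp_bump (k + 1) t) * v)" for v
      by (simp add: mult.commute)
  qed auto
qed

section \<open>Symmetry of second derivatives\<close>

text \<open>The mean value theorem is used twice: in direction \<open>u\<close> for the difference
  f(y + h v) - f(y), then in direction \<open>v\<close> for the derivative of \<open>f\<close> along
  \<open>u\<close>.\<close>

lemma second_difference_mean_value:
  fixes f :: "'a::euclidean_space \<Rightarrow> real"
  assumes "Ck_on 2 S f" "h > 0"
    and S: "\<And>s t. 0 \<le> s \<Longrightarrow> s \<le> h \<Longrightarrow> 0 \<le> t \<Longrightarrow> t \<le> h \<Longrightarrow> x + s *\<^sub>R u + t *\<^sub>R v \<in> S"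
  obtains s t where "0 \<le> s" "s \<le> h" "0 \<le> t" "t \<le> h"
    "f (x + h *\<^sub>R u + h *\<^sub>R v) - f (x + h *\<^sub>R u) - f (x + h *\<^sub>R v) + f x =
      h\<^sup>2 * frechet_derivative (\<lambda>y. frechet_derivative f (at y) u) (at (x + s *\<^sub>R u + t *\<^sub>R v)) v"
proof -
  define fu where "fu y = frechet_derivative f (at y) u" for y
  define fuv where "fuv y = frechet_derivative fu (at y) v" for y
  have C: "Ck_on (Suc (Suc 0)) S f" using assms(1) by (simp only: numeral_2_eq_2)
  have dfu: "((\<lambda>s. f (a + s *\<^sub>R u)) has_real_derivative fu (a + s *\<^sub>R u)) (at s)"
    if "a + s *\<^sub>R u \<in> S" for a s
  proof -
    have D: "(f has_derivative frechet_derivative f (at (a + s *\<^sub>R u))) (at (a + s *\<^sub>R u))"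
      by (rule Ck_on_has_derivative[OF C that])
    have "((\<lambda>s. a + s *\<^sub>R u) has_derivative (\<lambda>s. s *\<^sub>R u)) (at s)"
      by (auto intro!: derivative_eq_intros)
    from diff_chain_at[OF this D] show ?thesis
      using has_derivative_linear[OF D]
      by (simp add: has_field_derivative_def o_def fu_def linear_cmul mult_commute_abs)
  qed
  have dfuv: "((\<lambda>t. fu (a + t *\<^sub>R v)) has_real_derivative fuv (a + t *\<^sub>R v)) (at t)"
    if "a + t *\<^sub>R v \<in> S" for a t
  proof -
    have "Ck_on (Suc 0) S fu" unfolding fu_def using C by simp
    then have D: "(fu has_derivative frechet_derivative fu (at (a + t *\<^sub>R v))) (at (a + t *\<^sub>R v))"
      using Ck_on_has_derivative that by blast
    have "((\<lambda>t. a + t *\<^sub>R v) has_derivative (\<lambda>t. t *\<^sub>R v)) (at t)"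
      by (auto intro!: derivative_eq_intros)
    from diff_chain_at[OF this D] show ?thesis
      using has_derivative_linear[OF D]
      by (simp add: has_field_derivative_def o_def fuv_def linear_cmul mult_commute_abs)
  qed
  have "\<exists>s. 0 < s \<and> s < h \<and>
      (f ((x + h *\<^sub>R v) + h *\<^sub>R u) - f (x + h *\<^sub>R u)) - (f ((x + h *\<^sub>R v) + 0 *\<^sub>R u) - f (x + 0 *\<^sub>R u)) =
      (h - 0) * (fu ((x + h *\<^sub>R v) + s *\<^sub>R u) - fu (x + s *\<^sub>R u))"
    by (rule MVT2[of 0 h "\<lambda>s. f ((x + h *\<^sub>R v) + s *\<^sub>R u) - f (x + s *\<^sub>R u)"], fact)
      (intro DERIV_diff dfu, use S[of _ h] S[of _ 0] \<open>h > 0\<close> in \<open>auto simp: algebra_simps\<close>)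
  then obtain s where s: "0 < s" "s < h" and
    es: "f (x + h *\<^sub>R u + h *\<^sub>R v) - f (x + h *\<^sub>R u) - f (x + h *\<^sub>R v) + f x =
      h * (fu (x + s *\<^sub>R u + h *\<^sub>R v) - fu (x + s *\<^sub>R u))"
    by (auto simp: algebra_simps)
  have "\<exists>t. 0 < t \<and> t < h \<and>
      fu ((x + s *\<^sub>R u) + h *\<^sub>R v) - fu ((x + s *\<^sub>R u) + 0 *\<^sub>R v) = (h - 0) * fuv ((x + s *\<^sub>R u) + t *\<^sub>R v)"
    by (rule MVT2[of 0 h "\<lambda>t. fu ((x + s *\<^sub>R u) + t *\<^sub>R v)"], fact)
      (intro dfuv, use S[of s] s in auto)
  then obtain t where t: "0 < t" "t < h" and
    "fu (x + s *\<^sub>R u + h *\<^sub>R v) - fu (x + s *\<^sub>R u) = h * fuv (x + s *\<^sub>R u + t *\<^sub>R v)"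
    by auto
  then show thesis using that[of s t] s es by (simp add: fu_def[abs_def] fuv_def power2_eq_square)
qed

text \<open>The second difference is symmetric in \<open>u\<close> and \<open>v\<close>. It
  therefore makes the two mixed derivatives agree at two possibly different points near
  \<open>x\<close>, and continuity of both at \<open>x\<close> gives equality there.\<close>

lemma second_derivative_symmetric:
  fixes f :: "'a::euclidean_space \<Rightarrow> real"
  assumes "open S" "x \<in> S" "Ck_on 2 S f"
  shows "frechet_derivative (\<lambda>y. frechet_derivative f (at y) u) (at x) v =
    frechet_derivative (\<lambda>y. frechet_derivative f (at y) v) (at x) u"
proof -
  define F where "F u v y = frechet_derivative (\<lambda>y. frechet_derivative f (at y) u) (at y) v" for u v y
  have C: "Ck_on (Suc (Suc 0)) S f" using assms(3) by (simp only: numeral_2_eq_2)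
  then have cont: "isCont (F u v) x" for u v
    using assms(1,2) by (simp add: continuous_on_eq_continuous_at F_def[abs_def])
  have "dist (F u v x) (F v u x) < e" if "e > 0" for e
  proof -
    obtain d1 where d1: "d1 > 0" "\<And>y. dist y x < d1 \<Longrightarrow> dist (F u v y) (F u v x) < e / 2"
      using cont[of u v] \<open>e > 0\<close> half_gt_zero unfolding continuous_at_eps_delta by metis
    obtain d2 where d2: "d2 > 0" "\<And>y. dist y x < d2 \<Longrightarrow> dist (F v u y) (F v u x) < e / 2"
      using cont[of v u] \<open>e > 0\<close> half_gt_zero unfolding continuous_at_eps_delta by metis
    obtain d3 where d3: "d3 > 0" "ball x d3 \<subseteq> S" using assms(1,2) openE by blast
    define d where "d = min d1 (min d2 d3)"
    have "d > 0" using d1 d2 d3 by (simp add: d_def)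
    \<comment> \<open>This \<open>h\<close> keeps the whole parallelogram within distance
      \<open>d\<close> of \<open>x\<close>; the summand 1 keeps the denominator positive when
      \<open>u\<close> and \<open>v\<close> vanish.\<close>
    define h where "h = d / (norm u + norm v + 1)"
    have n: "norm u + norm v + 1 > 0" by (smt (verit) norm_ge_zero)
    then have "h > 0" using \<open>d > 0\<close> by (simp add: h_def)
    have near: "dist (x + s *\<^sub>R u + t *\<^sub>R v) x < d" if "0 \<le> s" "s \<le> h" "0 \<le> t" "t \<le> h" for s t
    proof -
      have "dist (x + s *\<^sub>R u + t *\<^sub>R v) x \<le> s * norm u + t * norm v"
        using norm_triangle_ineq[of "s *\<^sub>R u" "t *\<^sub>R v"] that by (simp add: dist_norm add.commute add.left_commute)
      also have "\<dots> \<le> h * norm u + h * norm v"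
        using that by (intro add_mono mult_right_mono) auto
      also have "\<dots> < h * (norm u + norm v + 1)" using \<open>h > 0\<close> by (simp add: algebra_simps)
      also have "\<dots> = d" using n by (simp add: h_def)
      finally show ?thesis .
    qed
    have inS: "x + s *\<^sub>R u + t *\<^sub>R v \<in> S" if "0 \<le> s" "s \<le> h" "0 \<le> t" "t \<le> h" for s t
      using near[OF that] d3(2) by (auto simp: d_def dist_commute)
    then have inS': "x + t *\<^sub>R v + s *\<^sub>R u \<in> S" if "0 \<le> t" "t \<le> h" "0 \<le> s" "s \<le> h" for s t
      using that by (metis add.assoc add.commute)
    obtain s t where st: "0 \<le> s" "s \<le> h" "0 \<le> t" "t \<le> h"
      "f (x + h *\<^sub>R u + h *\<^sub>R v) - f (x + h *\<^sub>R u) - f (x + h *\<^sub>R v) + f x = h\<^sup>2 * F u v (x + s *\<^sub>R u + t *\<^sub>R v)"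
      using second_difference_mean_value[OF assms(3) \<open>h > 0\<close> inS] unfolding F_def by blast
    obtain t' s' where st': "0 \<le> t'" "t' \<le> h" "0 \<le> s'" "s' \<le> h"
      "f (x + h *\<^sub>R v + h *\<^sub>R u) - f (x + h *\<^sub>R v) - f (x + h *\<^sub>R u) + f x = h\<^sup>2 * F v u (x + t' *\<^sub>R v + s' *\<^sub>R u)"
      using second_difference_mean_value[OF assms(3) \<open>h > 0\<close> inS'] unfolding F_def by blast
    have swap: "x + h *\<^sub>R v + h *\<^sub>R u = x + h *\<^sub>R u + h *\<^sub>R v" by (simp add: add.commute add.left_commute)
    have "h\<^sup>2 * F u v (x + s *\<^sub>R u + t *\<^sub>R v) = h\<^sup>2 * F v u (x + t' *\<^sub>R v + s' *\<^sub>R u)"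
      using st(5) st'(5)[unfolded swap] by linarith
    then have eq: "F u v (x + s *\<^sub>R u + t *\<^sub>R v) = F v u (x + t' *\<^sub>R v + s' *\<^sub>R u)"
      using \<open>h > 0\<close> by simp
    have "x + t' *\<^sub>R v + s' *\<^sub>R u = x + s' *\<^sub>R u + t' *\<^sub>R v" by (simp add: add.commute add.left_commute)
    then have "dist (x + t' *\<^sub>R v + s' *\<^sub>R u) x < d" using near[of s' t'] st'(1-4) by (simp only:)
    then show ?thesis
      using d1(2)[of "x + s *\<^sub>R u + t *\<^sub>R v"] d2(2)[of "x + t' *\<^sub>R v + s' *\<^sub>R u"] near[OF st(1-4)] eq
      by (auto simp: d_def dist_real_def abs_if split: if_splits)
  qed
  then have "dist (F u v x) (F v u x) = 0"
    by (metis dist_not_less_zero less_irrefl linorder_neqE)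
  then show ?thesis by (simp add: F_def)
qed

section \<open>Charts and derivatives on a manifold\<close>

lemma linear_axis_expand:
  fixes l :: "real ^ 'n::finite \<Rightarrow> 'b::real_vector"
  assumes "linear l"
  shows "l v = (\<Sum>i\<in>UNIV. (v $ i) *\<^sub>R l (axis i 1))"
proof -
  have "v = (\<Sum>i\<in>UNIV. (v $ i) *\<^sub>R axis i 1)"
    by (simp add: vec_eq_iff axis_def if_distrib cong: if_cong)
  then have "l v = l (\<Sum>i\<in>UNIV. (v $ i) *\<^sub>R axis i 1)" by (rule arg_cong)
  then show ?thesis using assms by (simp add: linear_sum linear_cmul)
qed

lemma Ck_on_vec_nth: "open S \<Longrightarrow> Ck_on k S f \<Longrightarrow> Ck_on k S (\<lambda>x. f x $ i)"
  by (rule Ck_on_bounded_linear_compose[OF _ bounded_linear_vec_nth])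

text \<open>The squared norm is a polynomial in the coordinates, hence smooth at the centre
  \<open>x\<close> as well, where the norm itself is not.\<close>

lemma Ck_on_norm_sq: "open S \<Longrightarrow> Ck_on k S (\<lambda>y::real ^ 'n::finite. r - (norm (y - x))\<^sup>2)"
proof -
  assume S: "open S"
  have d: "Ck_on k S (\<lambda>y. (y + - x) $ i)" for i
    by (intro Ck_on_vec_nth Ck_on_add Ck_on_id Ck_on_const S)
  have "Ck_on k S (\<lambda>y. r + (- 1) *\<^sub>R (\<Sum>i\<in>UNIV. ((y + - x) $ i) *\<^sub>R ((y + - x) $ i)))"
    using d by (intro Ck_on_add Ck_on_sum Ck_on_scaleR[OF S _ Ck_on_sum] Ck_on_scaleR Ck_on_const S)
  moreover have "(norm z)\<^sup>2 = (\<Sum>i\<in>UNIV. (z $ i) *\<^sub>R (z $ i))" for z :: "real ^ 'n"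
    by (simp add: power2_norm_eq_inner inner_vec_def)
  ultimately show ?thesis by simp
qed

section \<open>Derivatives at a point and change of charts\<close>

text \<open>Relational companion of \<open>deriv_at\<close>: it records differentiability, which the
  total function \<open>deriv_at\<close> cannot express. General values allow it to be applied to
  coordinate maps.\<close>

definition has_deriv_at ::
  "('m, 'n::finite) chart set \<Rightarrow> 'm \<Rightarrow> ('m \<Rightarrow> 'b::real_normed_vector) \<Rightarrow> (real ^ 'n \<Rightarrow> 'b) \<Rightarrow> bool" where
  "has_deriv_at A p f f' \<longleftrightarrow>
     ((f \<circ> chart_inv (chart_at A p)) has_derivative f') (at (snd (chart_at A p) p))"

lemma deriv_at_eq: "has_deriv_at A p f f' \<Longrightarrow> deriv_at A p v f = f' v"
  unfolding has_deriv_at_def deriv_at_def by (simp add: frechet_derivative_at[symmetric])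

text \<open>The differential of the change of coordinates from \<open>c\<close> to \<open>d\<close>.
  In particular \<open>transition (chart_at A p) c p v\<close> gives the components in
  \<open>c\<close> of the tangent vector represented by \<open>v\<close>.\<close>

definition transition :: "('m, 'n::finite) chart \<Rightarrow> ('m, 'n) chart \<Rightarrow> 'm \<Rightarrow> real ^ 'n \<Rightarrow> real ^ 'n" where
  "transition c d p = frechet_derivative (snd d \<circ> chart_inv c) (at (snd c p))"

locale smooth_manifold =
  fixes A :: "('m::{t2_space, second_countable_topology}, 'n::finite) chart set"
  assumes atlas: "smooth_atlas A"
begin

lemma chart_open:
  assumes "c \<in> A" shows "open (fst c)" "open (snd c ` fst c)"
  using assms atlas unfolding smooth_atlas_def by auto

lemma chart_homeomorphism: "c \<in> A \<Longrightarrow> homeomorphism (fst c) (snd c ` fst c) (snd c) (chart_inv c)"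
  using atlas unfolding smooth_atlas_def by auto

lemma chart_inv_snd: "c \<in> A \<Longrightarrow> p \<in> fst c \<Longrightarrow> chart_inv c (snd c p) = p"
  using chart_homeomorphism[of c] by (auto simp: homeomorphism_def)

lemma chart_inv_mem: "c \<in> A \<Longrightarrow> y \<in> snd c ` fst c \<Longrightarrow> chart_inv c y \<in> fst c"
  using chart_inv_snd[of c] by auto

lemma chart_at_mem: "chart_at A p \<in> A" "p \<in> fst (chart_at A p)"
proof -
  have "\<exists>c. c \<in> A \<and> p \<in> fst c" using atlas unfolding smooth_atlas_def by blast
  then have "chart_at A p \<in> A \<and> p \<in> fst (chart_at A p)" unfolding chart_at_def by (rule someI_ex)
  then show "chart_at A p \<in> A" "p \<in> fst (chart_at A p)" by auto
qed

lemma chart_image_eq: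
  "c \<in> A \<Longrightarrow> snd c ` (fst c \<inter> U) = snd c ` fst c \<inter> chart_inv c -` U"
  by (auto simp: chart_inv_snd intro!: imageI)

lemma open_chart_image: "c \<in> A \<Longrightarrow> open U \<Longrightarrow> open (snd c ` (fst c \<inter> U))"
  using chart_homeomorphism[of c] chart_open[of c]
  by (auto simp: chart_image_eq homeomorphism_def intro!: continuous_open_preimage)

lemma smooth_transition:
  "c \<in> A \<Longrightarrow> d \<in> A \<Longrightarrow> Ck_on k (snd c ` (fst c \<inter> fst d)) (snd d \<circ> chart_inv c)"
  using atlas unfolding smooth_atlas_def smooth_on_def by blast

lemma transition_has_derivative:
  assumes "c \<in> A" "d \<in> A" "p \<in> fst c" "p \<in> fst d"
  shows "((snd d \<circ> chart_inv c) has_derivative transition c d p) (at (snd c p))"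
  unfolding transition_def
  using Ck_on_has_derivative[OF smooth_transition[OF assms(1,2)]] assms by blast

text \<open>Chain rule for f c^-1 = (f d^-1)(d c^-1). This identity holds on the image of the
  overlap only, which is an open neighbourhood of \<open>snd c p\<close>.\<close>

lemma has_derivative_change_chart:
  assumes "c \<in> A" "d \<in> A" "p \<in> fst c" "p \<in> fst d"
    and "((f \<circ> chart_inv d) has_derivative f') (at (snd d p))"
  shows "((f \<circ> chart_inv c) has_derivative (\<lambda>v. f' (transition c d p v))) (at (snd c p))"
proof -
  have "((f \<circ> chart_inv d) has_derivative f') (at ((snd d \<circ> chart_inv c) (snd c p)))"
    using assms by (simp add: chart_inv_snd)
  from diff_chain_at[OF transition_has_derivative[OF assms(1-4)] this]
  have *: "((f \<circ> chart_inv d) \<circ> (snd d \<circ> chart_inv c) has_derivative (\<lambda>v. f' (transition c d p v)))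
      (at (snd c p))"
    by (simp only: o_def)
  show ?thesis
    by (rule has_derivative_transform_within_open[OF *, of "snd c ` (fst c \<inter> fst d)"])
      (use assms chart_open(1)[OF assms(2)] in \<open>auto simp: chart_inv_snd intro!: open_chart_image\<close>)
qed

lemma has_derivative_snd_chart_inv:
  assumes "c \<in> A" "p \<in> fst c"
  shows "((snd c \<circ> chart_inv c) has_derivative (\<lambda>v. v)) (at (snd c p))"
  by (rule has_derivative_transform_within_open[OF has_derivative_ident, of "snd c ` fst c"])
    (use assms chart_open in \<open>auto simp: chart_inv_snd\<close>)

lemma transition_self: "c \<in> A \<Longrightarrow> p \<in> fst c \<Longrightarrow> transition c c p v = v"
  using frechet_derivative_at[OF has_derivative_snd_chart_inv] unfolding transition_def by metis

lemma linear_transition: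
  "c \<in> A \<Longrightarrow> d \<in> A \<Longrightarrow> p \<in> fst c \<Longrightarrow> p \<in> fst d \<Longrightarrow> linear (transition c d p)"
  using transition_has_derivative has_derivative_linear by blast

text \<open>Both the identity and the composite of the two transitions are derivatives of
  \<open>snd c \<circ> chart_inv c\<close>.\<close>

lemma transition_inverse:
  assumes "c \<in> A" "d \<in> A" "p \<in> fst c" "p \<in> fst d"
  shows "transition d c p (transition c d p v) = v"
proof -
  have "((snd c \<circ> chart_inv c) has_derivative (\<lambda>v. transition d c p (transition c d p v))) (at (snd c p))"
    using has_derivative_change_chart[OF assms transition_has_derivative[OF assms(2,1,4,3)]] .
  then show ?thesis
    using has_derivative_unique[OF has_derivative_snd_chart_inv[OF assms(1,3)]] by metis
qed

lemma has_deriv_at_chart: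
  assumes "c \<in> A" "p \<in> fst c" "((f \<circ> chart_inv c) has_derivative f') (at (snd c p))"
  shows "has_deriv_at A p f (\<lambda>v. f' (transition (chart_at A p) c p v))"
  unfolding has_deriv_at_def
  by (rule has_derivative_change_chart) (use assms chart_at_mem in auto)

lemma has_derivative_chart:
  assumes "c \<in> A" "p \<in> fst c" "has_deriv_at A p f f'"
  shows "((f \<circ> chart_inv c) has_derivative (\<lambda>v. f' (transition c (chart_at A p) p v))) (at (snd c p))"
  using assms unfolding has_deriv_at_def
  by (intro has_derivative_change_chart) (use chart_at_mem in auto)

lemma has_deriv_at_coordinates:
  "c \<in> A \<Longrightarrow> p \<in> fst c \<Longrightarrow> has_deriv_at A p (snd c) (transition (chart_at A p) c p)"
  using has_deriv_at_chart[OF _ _ has_derivative_snd_chart_inv] by auto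

lemma has_deriv_at_cong:
  assumes "has_deriv_at A p f f'" "open U" "p \<in> U" "\<And>q. q \<in> U \<Longrightarrow> f q = g q"
  shows "has_deriv_at A p g f'"
  unfolding has_deriv_at_def
proof (rule has_derivative_transform_within_open)
  let ?c = "chart_at A p"
  show "(f \<circ> chart_inv ?c has_derivative f') (at (snd ?c p))" using assms unfolding has_deriv_at_def by blast
  show "open (snd ?c ` (fst ?c \<inter> U))" using assms chart_at_mem open_chart_image by blast
  show "snd ?c p \<in> snd ?c ` (fst ?c \<inter> U)" using assms chart_at_mem by blast
  show "\<And>y. y \<in> snd ?c ` (fst ?c \<inter> U) \<Longrightarrow> (f \<circ> chart_inv ?c) y = (g \<circ> chart_inv ?c) y"
    using assms(4) chart_inv_snd[OF chart_at_mem(1)] by auto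
qed

lemma has_deriv_at_scaleR:
  fixes f :: "'m \<Rightarrow> real"
  assumes "has_deriv_at A p f f'" "has_deriv_at A p g g'"
  shows "has_deriv_at A p (\<lambda>q. f q *\<^sub>R g q) (\<lambda>v. f p *\<^sub>R g' v + f' v *\<^sub>R g p)"
  using has_derivative_scaleR[OF assms[unfolded has_deriv_at_def]] chart_inv_snd[OF chart_at_mem]
  unfolding has_deriv_at_def by (simp add: o_def)

lemma has_deriv_at_mult:
  fixes f g :: "'m \<Rightarrow> real"
  assumes "has_deriv_at A p f f'" "has_deriv_at A p g g'"
  shows "has_deriv_at A p (\<lambda>q. f q * g q) (\<lambda>v. f p * g' v + f' v * g p)"
  using has_deriv_at_scaleR[OF assms] by simp

lemma has_deriv_at_add:
  "has_deriv_at A p f f' \<Longrightarrow> has_deriv_at A p g g' \<Longrightarrow> has_deriv_at A p (\<lambda>q. f q + g q) (\<lambda>v. f' v + g' v)"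
  unfolding has_deriv_at_def o_def by (rule has_derivative_add)

lemma has_deriv_at_const: "has_deriv_at A p (\<lambda>q. a) (\<lambda>v. 0)"
  unfolding has_deriv_at_def by (simp add: o_def)

lemma has_deriv_at_vec_nth:
  "has_deriv_at A p f f' \<Longrightarrow> has_deriv_at A p (\<lambda>q. f q $ i) (\<lambda>v. f' v $ i)"
  unfolding has_deriv_at_def o_def by (rule bounded_linear.has_derivative[OF bounded_linear_vec_nth])

lemma has_deriv_at_divide:
  fixes f g :: "'m \<Rightarrow> real"
  assumes "has_deriv_at A p f f'" "has_deriv_at A p g g'" "g p \<noteq> 0"
  obtains h where "has_deriv_at A p (\<lambda>q. f q / g q) h"
  using has_derivative_divide[OF assms(1,2)[unfolded has_deriv_at_def]] assms(3)
    chart_inv_snd[OF chart_at_mem]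
  unfolding has_deriv_at_def by (simp add: o_def)

section \<open>Algebra of smooth functions and vector fields\<close>

lemma smooth_funI:
  "(\<And>c k. c \<in> A \<Longrightarrow> Ck_on k (snd c ` fst c) (f \<circ> chart_inv c)) \<Longrightarrow> smooth_fun A f"
  unfolding smooth_fun_def smooth_on_def by blast

lemma smooth_funD: "smooth_fun A f \<Longrightarrow> c \<in> A \<Longrightarrow> Ck_on k (snd c ` fst c) (f \<circ> chart_inv c)"
  unfolding smooth_fun_def smooth_on_def by blast

lemma smooth_fun_has_derivative:
  assumes "smooth_fun A f" "c \<in> A" "y \<in> snd c ` fst c"
  shows "((f \<circ> chart_inv c) has_derivative frechet_derivative (f \<circ> chart_inv c) (at y)) (at y)"
  using Ck_on_has_derivative smooth_funD[OF assms(1,2)] assms(3) by blast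

lemma smooth_fun_has_deriv_at:
  "smooth_fun A f \<Longrightarrow> has_deriv_at A p f (\<lambda>v. deriv_at A p v f)"
  unfolding has_deriv_at_def deriv_at_def
  using smooth_fun_has_derivative chart_at_mem by (simp add: image_eqI)

lemma linear_deriv_at: "smooth_fun A f \<Longrightarrow> linear (\<lambda>v. deriv_at A p v f)"
  using smooth_fun_has_deriv_at has_derivative_linear unfolding has_deriv_at_def by blast

lemma smooth_fun_const: "smooth_fun A (\<lambda>q. a)"
  by (rule smooth_funI) (simp add: o_def Ck_on_const chart_open)

lemma smooth_fun_add: "smooth_fun A f \<Longrightarrow> smooth_fun A g \<Longrightarrow> smooth_fun A (\<lambda>q. f q + g q)"
  by (rule smooth_funI) (simp only: o_def, rule Ck_on_add,
      use chart_open smooth_funD[unfolded o_def] in auto)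

lemma smooth_fun_mult: "smooth_fun A f \<Longrightarrow> smooth_fun A g \<Longrightarrow> smooth_fun A (\<lambda>q. f q * g q)"
  by (rule smooth_funI) (simp only: o_def real_scaleR_def[symmetric], rule Ck_on_scaleR,
      use chart_open smooth_funD[unfolded o_def] in auto)

lemma smooth_fun_minus: "smooth_fun A f \<Longrightarrow> smooth_fun A (\<lambda>q. - f q)"
  using smooth_fun_mult[OF smooth_fun_const[of "- 1"]] by simp

lemma smooth_fun_diff: "smooth_fun A f \<Longrightarrow> smooth_fun A g \<Longrightarrow> smooth_fun A (\<lambda>q. f q - g q)"
  using smooth_fun_add smooth_fun_minus[of g] by fastforce

lemma smooth_fun_deriv_along: "X \<in> vector_fields A \<Longrightarrow> smooth_fun A f \<Longrightarrow> smooth_fun A (deriv_along A X f)"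
  unfolding vector_fields_def by blast

lemma deriv_along_mult:
  assumes "smooth_fun A f" "smooth_fun A g"
  shows "deriv_along A X (\<lambda>q. f q * g q) p = f p * deriv_along A X g p + deriv_along A X f p * g p"
  unfolding deriv_along_def
  using deriv_at_eq[OF has_deriv_at_mult[OF assms[THEN smooth_fun_has_deriv_at]]] .

lemma deriv_along_const: "deriv_along A X (\<lambda>q. a) p = 0"
  unfolding deriv_along_def using deriv_at_eq[OF has_deriv_at_const] .

lemma vector_fields_add:
  assumes "X \<in> vector_fields A" "Y \<in> vector_fields A"
  shows "(\<lambda>q. X q + Y q) \<in> vector_fields A"
proof -
  have "deriv_along A (\<lambda>q. X q + Y q) f = (\<lambda>q. deriv_along A X f q + deriv_along A Y f q)"
    if "smooth_fun A f" for f
    unfolding deriv_along_def using linear_add[OF linear_deriv_at[OF that]] by blast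
  then show ?thesis using assms smooth_fun_add unfolding vector_fields_def by simp
qed

lemma vector_fields_scaleR:
  assumes "smooth_fun A h" "X \<in> vector_fields A"
  shows "(\<lambda>q. h q *\<^sub>R X q) \<in> vector_fields A"
proof -
  have "deriv_along A (\<lambda>q. h q *\<^sub>R X q) f = (\<lambda>q. h q * deriv_along A X f q)"
    if "smooth_fun A f" for f
    unfolding deriv_along_def using linear_cmul[OF linear_deriv_at[OF that]] by simp
  then show ?thesis using assms smooth_fun_mult unfolding vector_fields_def by simp
qed

lemma vector_fields_diff:
  assumes "X \<in> vector_fields A" "Y \<in> vector_fields A"
  shows "(\<lambda>q. X q - Y q) \<in> vector_fields A"
  using vector_fields_add[OF assms(1) vector_fields_scaleR[OF smooth_fun_const[of "- 1"] assms(2)]] by simp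

lemma vector_fields_cmul: "X \<in> vector_fields A \<Longrightarrow> (\<lambda>q. a *\<^sub>R X q) \<in> vector_fields A"
  using vector_fields_scaleR[OF smooth_fun_const] .

lemma vector_fields_0: "(\<lambda>q. 0) \<in> vector_fields A"
proof -
  have "deriv_along A (\<lambda>q. 0) f = (\<lambda>q. 0)" if "smooth_fun A f" for f
    unfolding deriv_along_def using linear_0[OF linear_deriv_at[OF that]] by blast
  then show ?thesis using smooth_fun_const unfolding vector_fields_def by simp
qed

lemma vector_fields_sum:
  "(\<And>i. i \<in> I \<Longrightarrow> X i \<in> vector_fields A) \<Longrightarrow> (\<lambda>q. \<Sum>i\<in>I. X i q) \<in> vector_fields A"
  by (induction I rule: infinite_finite_induct) (auto intro: vector_fields_0 vector_fields_add)

section \<open>Bump functions, extension of vectors and tensoriality\<close>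

text \<open>The image of any other chart \<open>d\<close> is covered by two open sets: the overlap
  with \<open>c\<close>, where \<open>h\<close> is smooth by a change of coordinates, and the part
  outside \<open>K\<close>, where \<open>h\<close> is 0. The second is open since a compact set in a
  Hausdorff space is closed.\<close>

lemma smooth_fun_extend_by_zero:
  assumes "c \<in> A" "compact K" "K \<subseteq> fst c" "\<And>k. Ck_on k (snd c ` fst c) (h \<circ> chart_inv c)"
    and "\<And>q. q \<notin> K \<Longrightarrow> h q = 0"
  shows "smooth_fun A h"
proof (rule smooth_funI)
  fix d k assume d: "d \<in> A"
  define S where "S = snd d ` (fst d \<inter> fst c)"
  define T where "T = snd d ` (fst d \<inter> - K)"
  have "open S" "open T"
    using open_chart_image[OF d] chart_open(1)[OF assms(1)] compact_imp_closed[OF assms(2)]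
    by (auto simp: S_def T_def)
  have "Ck_on k S ((h \<circ> chart_inv c) \<circ> (snd c \<circ> chart_inv d))"
    by (rule Ck_on_compose[OF \<open>open S\<close> _ assms(4)])
      (use smooth_transition d assms(1) in \<open>auto simp: S_def chart_inv_snd\<close>)
  then have 1: "Ck_on k S (h \<circ> chart_inv d)"
    by (rule Ck_on_cong[OF \<open>open S\<close>]) (use d assms(1) in \<open>auto simp: S_def chart_inv_snd\<close>)
  have 2: "Ck_on k T (h \<circ> chart_inv d)"
    by (rule Ck_on_cong[OF \<open>open T\<close> Ck_on_const[OF \<open>open T\<close>, of _ 0]])
      (use d assms(5) in \<open>auto simp: T_def chart_inv_snd\<close>)
  have "Ck_on k (\<Union>{S, T}) (h \<circ> chart_inv d)"
    by (rule Ck_on_Union) (use 1 2 \<open>open S\<close> \<open>open T\<close> in auto)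
  moreover have "\<Union>{S, T} = snd d ` fst d" using assms(3) unfolding S_def T_def by auto
  ultimately show "Ck_on k (snd d ` fst d) (h \<circ> chart_inv d)" by simp
qed

text \<open>If \<open>x\<^sub>i\<close> are the coordinates of \<open>c\<close> and \<open>b\<close> is a bump function supported in \<open>c\<close>, then
  \<open>w\<^sub>i = b x\<^sub>i\<close> and \<open>E\<^sub>v = b \<partial>\<^sub>v\<close> are globally smooth, and the product rule turns
  \<open>b\<^sup>2 X(x\<^sub>i)\<close> into \<open>b X(w\<^sub>i) - w\<^sub>i X(b)\<close>. A single bump function thus gives the
  globally smooth expansion \<open>b\<^sup>3 X = \<Sum>\<^sub>i (b X(w\<^sub>i) - w\<^sub>i X(b)) E\<^sub>i\<close>.\<close>

lemma bump_frame:
  assumes c: "c \<in> A" and p: "p \<in> fst c"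
  obtains b w E where
    "smooth_fun A b" "b p \<noteq> 0" "\<forall>i. smooth_fun A (w i)" "\<forall>v. E v \<in> vector_fields A"
    "\<forall>v. E v p = b p *\<^sub>R transition c (chart_at A p) p v"
    "\<forall>X i q. q \<in> fst c \<longrightarrow> b q * deriv_along A X (w i) q - w i q * deriv_along A X b q =
       (b q)\<^sup>2 * transition (chart_at A q) c q (X q) $ i"
    "\<forall>X q. (b q) ^ 3 *\<^sub>R X q =
       (\<Sum>i\<in>UNIV. (b q * deriv_along A X (w i) q - w i q * deriv_along A X b q) *\<^sub>R E (axis i 1) q)"
proof -
  define x where "x = snd c p"
  obtain r where r: "r > 0" "cball x r \<subseteq> snd c ` fst c"
    using open_contains_cball chart_open(2)[OF c] p x_def by blast
  define K where "K = chart_inv c ` cball x r"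
  have cK: "compact K"
    unfolding K_def using chart_homeomorphism[OF c] r(2)
    by (intro compact_continuous_image) (auto simp: homeomorphism_def intro: continuous_on_subset)
  have KS: "K \<subseteq> fst c" unfolding K_def using chart_inv_mem[OF c] r(2) by auto
  have inK: "q \<in> K" if "q \<in> fst c" "norm (snd c q - x) \<le> r" for q
    unfolding K_def using chart_inv_snd[OF c] that
    by (metis dist_commute dist_norm image_eqI mem_cball)
  \<comment> \<open>The argument of \<open>exp_bump\<close> is positive exactly in the open
    coordinate ball of radius \<open>r\<close>, so that \<open>b\<close> vanishes outside
    \<open>K\<close> and is positive at the centre \<open>p\<close>.\<close>
  define b where "b q = (if q \<in> fst c then exp_bump 0 (r\<^sup>2 - (norm (snd c q - x))\<^sup>2) else 0)" for q
  have b0: "b q = 0" if "q \<notin> K" for q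
  proof (cases "q \<in> fst c")
    case True
    then have "r \<le> norm (snd c q - x)" using inK that by fastforce
    then have "r\<^sup>2 \<le> (norm (snd c q - x))\<^sup>2" using r(1) by (intro power_mono) auto
    then show ?thesis by (simp add: b_def exp_bump_def)
  qed (simp add: b_def)
  have Ckb: "Ck_on k (snd c ` fst c) (b \<circ> chart_inv c)" for k
  proof (rule Ck_on_cong)
    show "open (snd c ` fst c)" using chart_open c by blast
    show "Ck_on k (snd c ` fst c) (exp_bump 0 \<circ> (\<lambda>y. r\<^sup>2 - (norm (y - x))\<^sup>2))"
      by (rule Ck_on_compose[OF _ Ck_on_norm_sq Ck_on_exp_bump]) (use chart_open c in auto)
  qed (use c in \<open>auto simp: b_def chart_inv_snd\<close>)
  have sb: "smooth_fun A b" using smooth_fun_extend_by_zero[OF c cK KS Ckb b0] .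
  have bp: "b p \<noteq> 0" using p r(1) by (simp add: b_def x_def exp_bump_def)
  define w where "w i q = b q * snd c q $ i" for i q
  have sw: "smooth_fun A (w i)" for i
  proof (rule smooth_fun_extend_by_zero[OF c cK KS])
    fix k
    have o: "open (snd c ` fst c)" using chart_open c by blast
    show "Ck_on k (snd c ` fst c) (w i \<circ> chart_inv c)"
      by (rule Ck_on_cong[OF o Ck_on_scaleR[OF o Ckb Ck_on_vec_nth[OF o Ck_on_id[OF o], of k i]]])
        (use c in \<open>auto simp: w_def chart_inv_snd\<close>)
  qed (use b0 in \<open>simp add: w_def\<close>)
  \<comment> \<open>The coordinate field of \<open>c\<close> in direction \<open>v\<close>, cut off
    by \<open>b\<close>; \<open>transition\<close> carries its constant components in
    \<open>c\<close> to the representation of the tangent space at \<open>q\<close>.\<close>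
  define E where "E v q = (if q \<in> fst c then b q *\<^sub>R transition c (chart_at A q) q v else 0)" for v q
  have E: "deriv_along A (E v) f q = b q * frechet_derivative (f \<circ> chart_inv c) (at (snd c q)) v"
    if f: "smooth_fun A f" and q: "q \<in> fst c" for v f q
  proof -
    let ?d = "chart_at A q"
    have "((f \<circ> chart_inv c) has_derivative (\<lambda>v. deriv_at A q (transition c ?d q v) f)) (at (snd c q))"
      using has_derivative_chart[OF c q smooth_fun_has_deriv_at[OF f]] .
    from frechet_derivative_at[OF this]
    have "frechet_derivative (f \<circ> chart_inv c) (at (snd c q)) v = deriv_at A q (transition c ?d q v) f"
      by metis
    then show ?thesis
      using q linear_cmul[OF linear_deriv_at[OF f]] by (simp add: deriv_along_def E_def)
  qed
  have E0: "deriv_along A (E v) f q = 0" if f: "smooth_fun A f" and q: "q \<notin> K" for v f q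
    using b0[OF q] linear_0[OF linear_deriv_at[OF f]] by (simp add: E_def deriv_along_def)
  have vE: "E v \<in> vector_fields A" for v
    unfolding vector_fields_def
  proof (intro CollectI allI impI)
    fix f assume f: "smooth_fun A f"
    show "smooth_fun A (deriv_along A (E v) f)"
    proof (rule smooth_fun_extend_by_zero[OF c cK KS])
      fix k
      let ?S = "snd c ` fst c"
      have o: "open ?S" using chart_open c by blast
      have "Ck_on k ?S (\<lambda>y. frechet_derivative (f \<circ> chart_inv c) (at y) v)"
        using smooth_funD[OF f c, of "Suc k"] by simp
      then show "Ck_on k ?S (deriv_along A (E v) f \<circ> chart_inv c)"
        by (rule Ck_on_cong[OF o Ck_on_scaleR[OF o Ckb]])
          (use c E[OF f] in \<open>auto simp: chart_inv_snd\<close>)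
    qed (use E0[OF f] in auto)
  qed
  have comp: "b q * deriv_along A X (w i) q - w i q * deriv_along A X b q =
       (b q)\<^sup>2 * transition (chart_at A q) c q (X q) $ i" if q: "q \<in> fst c" for X i q
  proof -
    have "has_deriv_at A q (w i)
        (\<lambda>v. b q * (transition (chart_at A q) c q v $ i) + deriv_at A q v b * snd c q $ i)"
      unfolding w_def
      by (rule has_deriv_at_mult[OF smooth_fun_has_deriv_at[OF sb]
            has_deriv_at_vec_nth[OF has_deriv_at_coordinates[OF c q]]])
    from deriv_at_eq[OF this] show ?thesis
      by (simp add: deriv_along_def w_def algebra_simps power2_eq_square)
  qed
  have exp: "(b q) ^ 3 *\<^sub>R X q =
       (\<Sum>i\<in>UNIV. (b q * deriv_along A X (w i) q - w i q * deriv_along A X b q) *\<^sub>R E (axis i 1) q)"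
    for X q
  proof (cases "q \<in> fst c")
    case True
    let ?d = "chart_at A q"
    have l: "linear (transition c ?d q)" using linear_transition c True chart_at_mem by blast
    have "X q = transition c ?d q (transition ?d c q (X q))"
      using transition_inverse c True chart_at_mem by metis
    also have "\<dots> = (\<Sum>i\<in>UNIV. (transition ?d c q (X q) $ i) *\<^sub>R transition c ?d q (axis i 1))"
      by (rule linear_axis_expand[OF l])
    finally have X: "X q = (\<Sum>i\<in>UNIV. (transition ?d c q (X q) $ i) *\<^sub>R transition c ?d q (axis i 1))" .
    show ?thesis
      unfolding comp[OF True] by (subst X) (simp add: E_def True scaleR_sum_right power2_eq_square
          power3_eq_cube mult_ac)
  next
    case False
    then show ?thesis by (simp add: b_def w_def)
  qed
  have Ep: "E v p = b p *\<^sub>R transition c (chart_at A p) p v" for v using p by (simp add: E_def)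
  show thesis by (rule that[of b w E]) (use sb bp sw vE Ep comp exp in blast)+
qed

text \<open>In the chart chosen at \<open>p\<close> the transition is the identity, so dividing the
  frame field by the number \<open>b p\<close> gives the value \<open>v\<close>. This guarantees
  that the choice in \<open>extend_vec\<close> succeeds.\<close>

lemma vector_field_extension: "\<exists>X\<in>vector_fields A. X p = v"
proof -
  obtain b E where "b p \<noteq> 0" "\<forall>v. E v \<in> vector_fields A"
    "\<forall>v. E v p = b p *\<^sub>R transition (chart_at A p) (chart_at A p) p v"
    by (rule bump_frame[OF chart_at_mem]) (rule that, assumption+)
  then show ?thesis
    using vector_fields_cmul[of "E v" "1 / b p"] transition_self[OF chart_at_mem]
    by (intro bexI[of _ "\<lambda>q. (1 / b p) *\<^sub>R E v q"]) auto
qed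

lemma extend_vec: "extend_vec A p v \<in> vector_fields A" "extend_vec A p v p = v"
proof -
  have "\<exists>X. X \<in> vector_fields A \<and> X p = v" using vector_field_extension by blast
  then have "extend_vec A p v \<in> vector_fields A \<and> extend_vec A p v p = v"
    unfolding extend_vec_def by (rule someI_ex)
  then show "extend_vec A p v \<in> vector_fields A" "extend_vec A p v p = v" by auto
qed

text \<open>Apply \<Phi> to the global expansion of b^3 X in the fields of
  \<open>bump_frame\<close>. The coefficients are smooth functions and come out as their values at
  \<open>p\<close>, which depend on \<open>X p\<close> alone; finally divide by b(p)^3.\<close>

lemma tensorial:
  fixes \<Phi> :: "('m \<Rightarrow> real ^ 'n) \<Rightarrow> 'm \<Rightarrow> 'b::real_vector"
  assumes add: "\<And>X Y. X \<in> vector_fields A \<Longrightarrow> Y \<in> vector_fields A \<Longrightarrow>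
      \<Phi> (\<lambda>q. X q + Y q) p = \<Phi> X p + \<Phi> Y p"
    and hom: "\<And>f X. smooth_fun A f \<Longrightarrow> X \<in> vector_fields A \<Longrightarrow> \<Phi> (\<lambda>q. f q *\<^sub>R X q) p = f p *\<^sub>R \<Phi> X p"
    and XY: "X \<in> vector_fields A" "Y \<in> vector_fields A" "X p = Y p"
  shows "\<Phi> X p = \<Phi> Y p"
proof -
  obtain b w and E :: "real ^ 'n \<Rightarrow> 'm \<Rightarrow> real ^ 'n"
    where sb: "smooth_fun A b" and bp: "b p \<noteq> 0" and sw: "\<forall>i. smooth_fun A (w i)"
    and vE: "\<forall>v. E v \<in> vector_fields A"
    and exp: "\<forall>X q. (b q) ^ 3 *\<^sub>R X q =
       (\<Sum>i\<in>UNIV. (b q * deriv_along A X (w i) q - w i q * deriv_along A X b q) *\<^sub>R E (axis i 1) q)"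
    by (rule bump_frame[OF chart_at_mem, of p]) (rule that, assumption+)
  note sw = sw[rule_format] and vE = vE[rule_format] and exp = exp[rule_format]
  define C where "C X i q = b q * deriv_along A X (w i) q - w i q * deriv_along A X b q" for X i q
  have sum: "\<Phi> (\<lambda>q. \<Sum>i\<in>I. Z i q) p = (\<Sum>i\<in>I. \<Phi> (Z i) p)"
    if "\<And>i. Z i \<in> vector_fields A" for Z and I :: "'n set"
  proof (induction I rule: infinite_finite_induct)
    case empty
    show ?case using hom[OF smooth_fun_const[of 0] vector_fields_0] by simp
  next
    case (insert i I)
    then show ?case using add[of "Z i" "\<lambda>q. \<Sum>i\<in>I. Z i q"] that vector_fields_sum[of I Z] by simp
  qed (use finite in auto)
  have "(b p) ^ 3 *\<^sub>R \<Phi> X p = (\<Sum>i\<in>UNIV. C X i p *\<^sub>R \<Phi> (E (axis i 1)) p)" if X: "X \<in> vector_fields A" for X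
  proof -
    have sC: "smooth_fun A (C X i)" for i
      unfolding C_def using X sb sw
      by (intro smooth_fun_diff smooth_fun_mult smooth_fun_deriv_along) auto
    have "smooth_fun A (\<lambda>q. (b q) ^ 3)"
      using smooth_fun_mult[OF smooth_fun_mult[OF sb sb] sb] by (simp add: power3_eq_cube)
    then have "(b p) ^ 3 *\<^sub>R \<Phi> X p = \<Phi> (\<lambda>q. (b q) ^ 3 *\<^sub>R X q) p" using hom X by metis
    also have "\<dots> = \<Phi> (\<lambda>q. \<Sum>i\<in>UNIV. C X i q *\<^sub>R E (axis i 1) q) p" unfolding exp C_def ..
    also have "\<dots> = (\<Sum>i\<in>UNIV. \<Phi> (\<lambda>q. C X i q *\<^sub>R E (axis i 1) q) p)"
      by (rule sum) (use sC vE vector_fields_scaleR in blast)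
    finally show ?thesis using hom[OF sC vE] by simp
  qed
  moreover have "C X i p = C Y i p" for i
    using XY(3) by (simp add: C_def deriv_along_def)
  ultimately show ?thesis using XY(1,2) bp
    by (metis (no_types, lifting) power_not_zero scaleR_left_imp_eq sum.cong)
qed

section \<open>Vector fields in coordinates and the Lie bracket\<close>

lemma in_chart_eq: "c \<in> A \<Longrightarrow> q \<in> fst c \<Longrightarrow> in_chart A c X (snd c q) = transition (chart_at A q) c q (X q)"
  unfolding in_chart_def using deriv_at_eq[OF has_deriv_at_coordinates] by (simp add: chart_inv_snd)

text \<open>Vector fields are smooth through their action on global functions, while chart
  coordinates are only local. Near \<open>p\<close> the components are quotients of a globally
  smooth function by the square of a bump function.\<close>

lemma in_chart_differentiable:
  assumes "X \<in> vector_fields A" "c \<in> A" "p \<in> fst c"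
  shows "in_chart A c X differentiable at (snd c p)"
proof -
  obtain b w where b: "smooth_fun A b" "b p \<noteq> 0" and w: "\<forall>i. smooth_fun A (w i)"
    and comp: "\<forall>X i q. q \<in> fst c \<longrightarrow> b q * deriv_along A X (w i) q - w i q * deriv_along A X b q =
       (b q)\<^sup>2 * transition (chart_at A q) c q (X q) $ i"
    by (rule bump_frame[OF assms(2,3)]) (rule that, assumption+)
  note w = w[rule_format] and comp = comp[rule_format]
  let ?S = "snd c ` fst c"
  have S: "open ?S" "snd c p \<in> ?S" using chart_open assms by auto
  define N where "N i q = b q * deriv_along A X (w i) q - w i q * deriv_along A X b q" for i q
  have N: "smooth_fun A (N i)" for i
    unfolding N_def using assms(1) b w
    by (intro smooth_fun_diff smooth_fun_mult smooth_fun_deriv_along) auto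
  define U where "U = {y \<in> ?S. (b \<circ> chart_inv c) y \<noteq> 0}"
  have "continuous_on ?S (b \<circ> chart_inv c)" using smooth_funD[OF b(1) assms(2), of 0] by simp
  then have "open U"
    unfolding U_def using continuous_open_preimage[OF _ S(1), of "b \<circ> chart_inv c" "- {0}"]
    by (simp add: vimage_def Int_def open_Compl)
  have pU: "snd c p \<in> U" using S(2) b(2) assms by (simp add: U_def chart_inv_snd)
  have "(\<lambda>y. in_chart A c X y $ i) differentiable at (snd c p)" for i
  proof -
    have "(\<lambda>y. (N i \<circ> chart_inv c) y / ((b \<circ> chart_inv c) y)\<^sup>2) differentiable at (snd c p)"
      using smooth_fun_has_derivative[OF N assms(2) S(2)] smooth_fun_has_derivative[OF b(1) assms(2) S(2)]
        b(2) chart_inv_snd[OF assms(2,3)]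
      by (intro differentiable_divide differentiable_power) (auto simp: o_def intro: differentiableI)
    then obtain D where "((\<lambda>y. (N i \<circ> chart_inv c) y / ((b \<circ> chart_inv c) y)\<^sup>2) has_derivative D)
        (at (snd c p))"
      unfolding differentiable_def by blast
    then have "((\<lambda>y. in_chart A c X y $ i) has_derivative D) (at (snd c p))"
      by (rule has_derivative_transform_within_open[OF _ \<open>open U\<close> pU])
        (use comp in_chart_eq[OF assms(2)] assms(2) in \<open>auto simp: U_def N_def chart_inv_snd\<close>)
    then show ?thesis by (rule differentiableI)
  qed
  then show ?thesis
    by (subst differentiable_componentwise_within) (auto simp: Basis_vec_def cart_eq_inner_axis[symmetric])
qed

lemma deriv_along_in_chart:
  assumes "smooth_fun A f" "c \<in> A" "y \<in> snd c ` fst c"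
  shows "deriv_along A X f (chart_inv c y) = frechet_derivative (f \<circ> chart_inv c) (at y) (in_chart A c X y)"
proof -
  obtain q where q: "q \<in> fst c" "y = snd c q" using assms(3) by blast
  have "has_deriv_at A q f
      (\<lambda>v. frechet_derivative (f \<circ> chart_inv c) (at y) (transition (chart_at A q) c q v))"
    using has_deriv_at_chart[OF assms(2) q(1)] smooth_fun_has_derivative[OF assms] q(2) by blast
  from deriv_at_eq[OF this] show ?thesis
    using in_chart_eq assms(2) q by (simp add: deriv_along_def chart_inv_snd)
qed

text \<open>In the chart chosen at \<open>p\<close>, each iterated derivative is a Hessian term plus
  a first-order term. The Hessian terms agree by symmetry and cancel; the first-order terms form the
  coordinate formula of the bracket.\<close>

lemma deriv_along_lie_bracket:
  assumes X: "X \<in> vector_fields A" and Y: "Y \<in> vector_fields A" and f: "smooth_fun A f"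
  shows "deriv_along A (lie_bracket A X Y) f p =
    deriv_along A X (deriv_along A Y f) p - deriv_along A Y (deriv_along A X f) p"
proof -
  define c where "c = chart_at A p"
  have c: "c \<in> A" "p \<in> fst c" unfolding c_def by (rule chart_at_mem)+
  define x where "x = snd c p"
  let ?S = "snd c ` fst c"
  have S: "open ?S" "x \<in> ?S" using chart_open c x_def by auto
  define F where "F = f \<circ> chart_inv c"
  define dF where "dF i y = frechet_derivative F (at y) (axis i 1)" for i y
  define D where "D Z = frechet_derivative (in_chart A c Z) (at x)" for Z
  have F2: "Ck_on (Suc (Suc 0)) ?S F" unfolding F_def using smooth_funD[OF f c(1)] .
  have linF: "linear (frechet_derivative F (at y))" if "y \<in> ?S" for y
    using has_derivative_linear[OF Ck_on_has_derivative[OF F2 that]] .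
  have dF: "(dF i has_derivative frechet_derivative (dF i) (at x)) (at x)" for i
    by (rule Ck_on_has_derivative[of 0 ?S]) (use F2 S(2) in \<open>auto simp: dF_def[abs_def]\<close>)
  have inx: "in_chart A c Z x = Z p" for Z
    using in_chart_eq[OF c] transition_self[OF c] by (simp add: c_def x_def)
  \<comment> \<open>Product rule for Wf = \<Sum>i W^i \<partial>i F, differentiated along
    \<open>Z\<close>.\<close>
  have main: "deriv_along A Z (deriv_along A W f) p =
      (\<Sum>i\<in>UNIV. \<Sum>j\<in>UNIV. W p $ i * (Z p $ j * frechet_derivative (dF i) (at x) (axis j 1)))
      + frechet_derivative F (at x) (D W (Z p))"
    if W: "W \<in> vector_fields A" for Z W
  proof -
    have DW: "(in_chart A c W has_derivative D W) (at x)"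
      unfolding D_def x_def using in_chart_differentiable[OF W c] frechet_derivative_works by blast
    then have "((\<lambda>y. in_chart A c W y $ i) has_derivative (\<lambda>v. D W v $ i)) (at x)" for i
      by (rule bounded_linear.has_derivative[OF bounded_linear_vec_nth])
    then have "((\<lambda>y. \<Sum>i\<in>UNIV. in_chart A c W y $ i * dF i y) has_derivative
        (\<lambda>v. \<Sum>i\<in>UNIV. in_chart A c W x $ i * frechet_derivative (dF i) (at x) v + D W v $ i * dF i x)) (at x)"
      by (rule has_derivative_sum[OF has_derivative_mult[OF _ dF]])
    then have "(deriv_along A W f \<circ> chart_inv c has_derivative
        (\<lambda>v. \<Sum>i\<in>UNIV. in_chart A c W x $ i * frechet_derivative (dF i) (at x) v + D W v $ i * dF i x)) (at x)"
    proof (rule has_derivative_transform_within_open[OF _ S])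
      fix y assume y: "y \<in> ?S"
      show "(\<Sum>i\<in>UNIV. in_chart A c W y $ i * dF i y) = (deriv_along A W f \<circ> chart_inv c) y"
        using deriv_along_in_chart[OF f c(1) y, of W] linear_axis_expand[OF linF[OF y], of "in_chart A c W y"]
        by (simp add: F_def dF_def)
    qed
    then have "has_deriv_at A p (deriv_along A W f)
        (\<lambda>v. \<Sum>i\<in>UNIV. in_chart A c W x $ i * frechet_derivative (dF i) (at x) v + D W v $ i * dF i x)"
      unfolding has_deriv_at_def c_def[symmetric] x_def[symmetric] .
    from deriv_at_eq[OF this] have "deriv_along A Z (deriv_along A W f) p =
      (\<Sum>i\<in>UNIV. W p $ i * frechet_derivative (dF i) (at x) (Z p)) + (\<Sum>i\<in>UNIV. D W (Z p) $ i * dF i x)"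
      by (simp add: deriv_along_def inx sum.distrib)
    moreover have "frechet_derivative (dF i) (at x) (Z p) =
        (\<Sum>j\<in>UNIV. Z p $ j * frechet_derivative (dF i) (at x) (axis j 1))" for i
      using linear_axis_expand[OF has_derivative_linear[OF dF], of i "Z p"] by simp
    moreover have "frechet_derivative F (at x) (D W (Z p)) = (\<Sum>i\<in>UNIV. D W (Z p) $ i * dF i x)"
      using linear_axis_expand[OF linF[OF S(2)], of "D W (Z p)"] by (simp add: dF_def)
    ultimately show ?thesis by (simp add: sum_distrib_left)
  qed
  have sym: "frechet_derivative (dF i) (at x) (axis j 1) = frechet_derivative (dF j) (at x) (axis i 1)" for i j
    unfolding dF_def using second_derivative_symmetric[OF S] F2 by (simp only: numeral_2_eq_2)
  have "(\<Sum>i\<in>UNIV. \<Sum>j\<in>UNIV. Y p $ i * (X p $ j * frechet_derivative (dF i) (at x) (axis j 1))) =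
      (\<Sum>i\<in>UNIV. \<Sum>j\<in>UNIV. Y p $ j * (X p $ i * frechet_derivative (dF j) (at x) (axis i 1)))"
    by (rule sum.swap)
  also have "\<dots> = (\<Sum>i\<in>UNIV. \<Sum>j\<in>UNIV. X p $ i * (Y p $ j * frechet_derivative (dF i) (at x) (axis j 1)))"
    using sym by (intro sum.cong) (auto simp: mult_ac)
  finally have "deriv_along A X (deriv_along A Y f) p - deriv_along A Y (deriv_along A X f) p =
      frechet_derivative F (at x) (D Y (X p)) - frechet_derivative F (at x) (D X (Y p))"
    using main[OF Y, of X] main[OF X, of Y] by simp
  also have "\<dots> = frechet_derivative F (at x) (lie_bracket A X Y p)"
    using linear_diff[OF linF[OF S(2)]] by (simp add: lie_bracket_def D_def c_def x_def Let_def)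
  also have "\<dots> = deriv_along A (lie_bracket A X Y) f p"
    unfolding deriv_along_def deriv_at_def F_def c_def x_def ..
  finally show ?thesis ..
qed

end

section \<open>Curvature in a single tangent space\<close>

text \<open>The vectors \<open>adjoint l 1\<close> and \<open>adjoint k 1\<close> represent the two
  forms. They span at most a plane, so some nonzero vector of 3-space is orthogonal to both.\<close>

lemma exists_common_zero:
  fixes l k :: "real ^ 3 \<Rightarrow> real"
  assumes "linear l" "linear k"
  shows "\<exists>v. v \<noteq> 0 \<and> l v = 0 \<and> k v = 0"
proof -
  let ?S = "{adjoint l 1, adjoint k 1}"
  have "dim ?S \<le> card ?S" by (rule dim_le_card') simp
  also have "card ?S \<le> 2" by (simp add: card_insert_if)
  finally have "dim ?S < DIM(real ^ 3)" by simp
  then obtain v where v: "v \<noteq> 0" "\<And>y. y \<in> span ?S \<Longrightarrow> orthogonal v y"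
    using orthogonal_to_subspace_exists by blast
  have "v \<bullet> adjoint l 1 = 0" "v \<bullet> adjoint k 1 = 0"
    using v(2) by (auto simp: orthogonal_def span_base)
  then show ?thesis using v(1) adjoint_works[OF assms(1), of v 1] adjoint_works[OF assms(2), of v 1] by auto
qed

text \<open>The map is the sum of the rank one maps sending v to t_k(v) f(b_k), whose traces are
  t_k(f(b_k)). This allows traces to be computed in an orthogonal frame.\<close>

lemma trace_expand:
  fixes f :: "real ^ 'n::finite \<Rightarrow> real ^ 'n"
  assumes f: "linear f" and t: "\<And>k. k \<in> K \<Longrightarrow> linear (t k)"
    and exp: "\<And>v. v = (\<Sum>k\<in>K. t k v *\<^sub>R b k)"
  shows "trace (matrix f) = (\<Sum>k\<in>K. t k (f (b k)))"
proof -
  have "f (axis i 1) $ i = (\<Sum>k\<in>K. f (b k) $ i * t k (axis i 1))" for i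
  proof -
    have "f (axis i 1) = f (\<Sum>k\<in>K. t k (axis i 1) *\<^sub>R b k)" using exp by (rule arg_cong)
    then show ?thesis using f by (simp add: linear_sum linear_cmul mult.commute)
  qed
  then have "trace (matrix f) = (\<Sum>i\<in>UNIV. \<Sum>k\<in>K. f (b k) $ i * t k (axis i 1))"
    by (simp add: trace_def matrix_def)
  also have "\<dots> = (\<Sum>k\<in>K. \<Sum>i\<in>UNIV. f (b k) $ i * t k (axis i 1))" by (rule sum.swap)
  also have "\<dots> = (\<Sum>k\<in>K. t k (f (b k)))"
    using linear_axis_expand[OF t] by (intro sum.cong) auto
  finally show ?thesis .
qed

locale paracontact_space =
  fixes g :: "real ^ 3 \<Rightarrow> real ^ 3 \<Rightarrow> real"
    and \<phi> :: "real ^ 3 \<Rightarrow> real ^ 3" and \<xi> :: "real ^ 3" and \<eta> :: "real ^ 3 \<Rightarrow> real" and \<epsilon> :: real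
  assumes bilinear: "bilinear g" and sym: "g u v = g v u" and nondegenerate: "(\<And>v. g u v = 0) \<Longrightarrow> u = 0"
    and linear_phi: "linear \<phi>" and linear_eta: "linear \<eta>" and eps: "\<epsilon> \<in> {1, - 1}"
    and phi_phi: "\<phi> (\<phi> v) = v - \<eta> v *\<^sub>R \<xi>" and eta_xi: "\<eta> \<xi> = 1" and phi_xi: "\<phi> \<xi> = 0"
    and eta_phi: "\<eta> (\<phi> v) = 0"
    and compatible: "g (\<phi> u) (\<phi> v) = g u v - \<epsilon> * \<eta> u * \<eta> v"
begin

lemmas g_simps = bilinear_ladd[OF bilinear] bilinear_radd[OF bilinear] bilinear_lmul[OF bilinear]
  bilinear_rmul[OF bilinear] bilinear_lsub[OF bilinear] bilinear_rsub[OF bilinear]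
  bilinear_lneg[OF bilinear] bilinear_rneg[OF bilinear] bilinear_lzero[OF bilinear] bilinear_rzero[OF bilinear]

lemmas eta_simps = linear_add[OF linear_eta] linear_cmul[OF linear_eta] linear_diff[OF linear_eta]
  linear_0[OF linear_eta] linear_neg[OF linear_eta] eta_xi eta_phi

lemma linear_g_right: "linear (g u)"
  using bilinear unfolding bilinear_def by auto

lemma eps_sq: "\<epsilon> * \<epsilon> = 1" using eps by auto

lemma g_xi: "g \<xi> v = \<epsilon> * \<eta> v"
  using compatible[of \<xi> v] by (simp add: phi_xi g_simps eta_xi)

lemma g_xi': "g v \<xi> = \<epsilon> * \<eta> v"
  using g_xi[of v] sym[of v \<xi>] by metis

text \<open>If \<open>g\<close> vanished on the diagonal of the kernel, it would vanish on the
  kernel by polarization. Since \<xi> is orthogonal to the kernel, a nonzero kernel vector would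
  then be orthogonal to everything.\<close>

lemma exists_nonnull: "\<exists>e. \<eta> e = 0 \<and> g e e \<noteq> 0"
proof (rule ccontr)
  assume "\<nexists>e. \<eta> e = 0 \<and> g e e \<noteq> 0"
  then have null: "g e e = 0" if "\<eta> e = 0" for e using that by blast
  obtain v where v: "v \<noteq> 0" "\<eta> v = 0" using exists_common_zero[OF linear_eta linear_eta] by blast
  have "g v u = 0" for u
  proof -
    define w where "w = u - \<eta> u *\<^sub>R \<xi>"
    have w: "\<eta> w = 0" by (simp add: w_def eta_simps)
    then have "g (v + w) (v + w) = 0" using v by (intro null) (simp add: eta_simps)
    then have "g v w = 0" using null[OF w] null[OF v(2)] sym[of w v] by (simp add: g_simps)
    then show ?thesis by (simp add: w_def g_simps g_xi' v)
  qed
  then show False using nondegenerate v(1) by blast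
qed

text \<open>As \<open>g\<close> may be indefinite, nullity has to be excluded at each stage:
  \<open>e1\<close> is chosen nonnull, and \<open>e2\<close>, orthogonal to \<xi> and
  \<open>e1\<close>, cannot be null without being orthogonal to the whole space.\<close>

lemma orthogonal_frame:
  obtains e1 e2 where "\<eta> e1 = 0" "\<eta> e2 = 0" "g e1 e2 = 0" "g e1 e1 \<noteq> 0" "g e2 e2 \<noteq> 0"
    "\<And>u. u = \<eta> u *\<^sub>R \<xi> + (g u e1 / g e1 e1) *\<^sub>R e1 + (g u e2 / g e2 e2) *\<^sub>R e2"
proof -
  obtain e1 where e1: "\<eta> e1 = 0" "g e1 e1 \<noteq> 0" using exists_nonnull by blast
  obtain e2 where e2: "e2 \<noteq> 0" "\<eta> e2 = 0" "g e1 e2 = 0"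
    using exists_common_zero[OF linear_eta linear_g_right] by blast
  have e21: "g e2 e1 = 0" using e2 sym by simp
  \<comment> \<open>Injectivity of \<open>M\<close> says that \<xi>, \<open>e1\<close>,
    \<open>e2\<close> are independent; in dimension 3 it gives surjectivity, that is,
    spanning.\<close>
  define M where "M a = a $ 1 *\<^sub>R \<xi> + a $ 2 *\<^sub>R e1 + a $ 3 *\<^sub>R e2" for a :: "real ^ 3"
  have "linear M" by (rule linearI) (simp_all add: M_def algebra_simps)
  moreover have "a = 0" if "M a = 0" for a
  proof -
    have 1: "a $ 1 = 0" using arg_cong[OF that, of \<eta>] by (simp add: M_def eta_simps e1 e2)
    have "g (M a) e1 = 0" using that by (simp add: g_simps)
    then have 2: "a $ 2 = 0" using e1 by (simp add: M_def g_simps g_xi e21)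
    have "a $ 3 = 0" using that 1 2 e2 by (simp add: M_def)
    then show ?thesis using 1 2 by (simp add: vec_eq_iff forall_3)
  qed
  ultimately have "surj M" using linear_injective_0 linear_injective_imp_surjective by blast
  then have span: "\<exists>a b c. u = a *\<^sub>R \<xi> + b *\<^sub>R e1 + c *\<^sub>R e2" for u
    unfolding surj_def M_def by blast
  have e22: "g e2 e2 \<noteq> 0"
  proof
    assume "g e2 e2 = 0"
    then have "g e2 u = 0" for u
      using span[of u] e2 e21 by (auto simp: g_simps g_xi')
    then show False using nondegenerate e2(1) by blast
  qed
  have "u = \<eta> u *\<^sub>R \<xi> + (g u e1 / g e1 e1) *\<^sub>R e1 + (g u e2 / g e2 e2) *\<^sub>R e2" for u
    using span[of u] e1 e2 e21 e22 by (auto simp: g_simps g_xi eta_simps)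
  then show thesis using that e1 e2 e22 by blast
qed

end

text \<open>The algebraic properties of the curvature of an \<open>\<epsilon>\<close>-para Sasakian manifold at a point that
  enter the proof; the first Bianchi identity is not among them.\<close>

locale paracontact_curvature = paracontact_space +
  fixes R :: "real ^ 3 \<Rightarrow> real ^ 3 \<Rightarrow> real ^ 3 \<Rightarrow> real ^ 3"
  assumes linear_R1: "linear (\<lambda>u. R u v w)" and linear_R2: "linear (\<lambda>v. R u v w)"
    and linear_R3: "linear (R u v)"
    and R_antisym: "R v u w = - R u v w" and R_skew: "g (R u v w) w = 0"
    and R_xi: "R u v \<xi> = \<eta> u *\<^sub>R v - \<eta> v *\<^sub>R u"
begin

text \<open>Pointwise counterparts of \<open>ricci\<close>, \<open>ricci_op\<close> and
  \<open>scalar_curvature\<close>, written with the same \<open>trace\<close> and \<open>THE\<close>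
  so that \<open>Ric_eq\<close> and \<open>scal_eq\<close> identify them by unfolding.\<close>

definition Ric :: "real ^ 3 \<Rightarrow> real ^ 3 \<Rightarrow> real" where
  "Ric v w = trace (matrix (\<lambda>u. R u v w))"

definition Ric_op :: "real ^ 3 \<Rightarrow> real ^ 3" where
  "Ric_op u = (THE w. \<forall>v. g w v = Ric u v)"

definition scal :: real where
  "scal = trace (matrix Ric_op)"

lemmas R_simps = linear_add[OF linear_R1] linear_cmul[OF linear_R1] linear_0[OF linear_R1]
  linear_add[OF linear_R2] linear_cmul[OF linear_R2] linear_0[OF linear_R2]
  linear_add[OF linear_R3] linear_cmul[OF linear_R3] linear_0[OF linear_R3]

lemma R_same: "R u u w = 0"
  using R_antisym[of u u w] by (metis add.inverse_inverse eq_neg_iff_add_eq_0 scaleR_2 scaleR_eq_0_iff zero_neq_numeral)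

text \<open>Polarization of \<open>R_skew\<close>.\<close>

lemma R_skew': "g (R u v w) z = - g (R u v z) w"
proof -
  have "g (R u v (w + z)) (w + z) = 0" by (rule R_skew)
  then show ?thesis by (simp add: R_simps g_simps R_skew)
qed

lemma bilinear_Ric: "bilinear Ric"
  unfolding bilinear_def Ric_def trace_def matrix_def
  by (auto intro!: linearI simp: R_simps sum.distrib sum_distrib_left)

lemma Ric_op: "g (Ric_op u) v = Ric u v"
proof -
  obtain e1 e2 where e: "\<eta> e1 = 0" "\<eta> e2 = 0" "g e1 e2 = 0" "g e1 e1 \<noteq> 0" "g e2 e2 \<noteq> 0"
    "\<And>u. u = \<eta> u *\<^sub>R \<xi> + (g u e1 / g e1 e1) *\<^sub>R e1 + (g u e2 / g e2 e2) *\<^sub>R e2"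
    using orthogonal_frame by blast
  \<comment> \<open>The vector dual to \<open>Ric u\<close> in the orthogonal frame; the first
    coefficient is divided by g(\<xi>, \<xi>) = \<epsilon>, which is its own inverse.\<close>
  define w where "w = (\<epsilon> * Ric u \<xi>) *\<^sub>R \<xi> + (Ric u e1 / g e1 e1) *\<^sub>R e1 + (Ric u e2 / g e2 e2) *\<^sub>R e2"
  have "g w v = Ric u v" for v
  proof -
    have "Ric u v = Ric u (\<eta> v *\<^sub>R \<xi> + (g v e1 / g e1 e1) *\<^sub>R e1 + (g v e2 / g e2 e2) *\<^sub>R e2)"
      using e(6) by (rule arg_cong)
    also have "\<dots> = \<eta> v * Ric u \<xi> + (g v e1 / g e1 e1) * Ric u e1 + (g v e2 / g e2 e2) * Ric u e2"
      by (simp add: bilinear_radd[OF bilinear_Ric] bilinear_rmul[OF bilinear_Ric])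
    also have "\<dots> = (\<epsilon> * \<epsilon>) * Ric u \<xi> * \<eta> v + Ric u e1 / g e1 e1 * g e1 v + Ric u e2 / g e2 e2 * g e2 v"
      by (simp add: eps_sq sym[of v] mult.commute)
    also have "\<dots> = g w v" by (simp add: w_def g_simps g_xi)
    finally show ?thesis ..
  qed
  moreover have "z = z'" if "\<forall>v. g z v = Ric u v" "\<forall>v. g z' v = Ric u v" for z z'
    using nondegenerate[of "z - z'"] that by (simp add: g_simps)
  ultimately have "\<exists>!w. \<forall>v. g w v = Ric u v" by blast
  then have "\<forall>v. g (Ric_op u) v = Ric u v" unfolding Ric_op_def by (rule theI')
  then show ?thesis by blast
qed

lemma linear_Ric_op: "linear Ric_op"
proof (rule linearI)
  fix u v show "Ric_op (u + v) = Ric_op u + Ric_op v"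
    using nondegenerate[of "Ric_op (u + v) - (Ric_op u + Ric_op v)"]
    by (simp add: g_simps Ric_op bilinear_ladd[OF bilinear_Ric])
next
  fix a u show "Ric_op (a *\<^sub>R u) = a *\<^sub>R Ric_op u"
    using nondegenerate[of "Ric_op (a *\<^sub>R u) - a *\<^sub>R Ric_op u"]
    by (simp add: g_simps Ric_op bilinear_lmul[OF bilinear_Ric])
qed

text \<open>In dimension 3 the kernel of \<open>\<eta>\<close> is a plane, so that the curvature restricted to it is given by a
  single number, whereas the remaining components are determined by \<open>R_xi\<close>.\<close>

lemma
  shows Ric_on_kernel: "\<eta> v = 0 \<Longrightarrow> \<eta> w = 0 \<Longrightarrow> Ric v w = (scal / 2 + \<epsilon>) * g v w"
    and R_on_kernel: "\<eta> u = 0 \<Longrightarrow> \<eta> v = 0 \<Longrightarrow>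
      g (R u v v) u = (scal / 2 + 2 * \<epsilon>) * (g u u * g v v - (g u v)\<^sup>2)"
proof -
  obtain e1 e2 where e: "\<eta> e1 = 0" "\<eta> e2 = 0" "g e1 e2 = 0" "g e1 e1 \<noteq> 0" "g e2 e2 \<noteq> 0"
    and exp: "\<And>u. u = \<eta> u *\<^sub>R \<xi> + (g u e1 / g e1 e1) *\<^sub>R e1 + (g u e2 / g e2 e2) *\<^sub>R e2"
    using orthogonal_frame by blast
  have e21: "g e2 e1 = 0" using e sym by simp
  \<comment> \<open>The frame \<xi>, e1, e2 and its coordinate functionals, indexed by 0, 1, 2 for
    \<open>trace_expand\<close>.\<close>
  define t :: "nat \<Rightarrow> real ^ 3 \<Rightarrow> real" where
    "t k = (if k = 0 then \<eta> else if k = 1 then (\<lambda>u. g u e1 / g e1 e1) else (\<lambda>u. g u e2 / g e2 e2))" for k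
  define b :: "nat \<Rightarrow> real ^ 3" where "b k = (if k = 0 then \<xi> else if k = 1 then e1 else e2)" for k
  have tr: "trace (matrix f) = \<eta> (f \<xi>) + g (f e1) e1 / g e1 e1 + g (f e2) e2 / g e2 e2" if "linear f" for f
  proof -
    have "linear (\<lambda>u. g u e / c)" for e c
      by (rule linearI) (simp_all add: g_simps add_divide_distrib)
    then have "trace (matrix f) = (\<Sum>k\<in>{..<3}. t k (f (b k)))"
      using exp linear_eta by (intro trace_expand[OF that]) (auto simp: t_def b_def numeral_3_eq_3)
    then show ?thesis by (simp add: t_def b_def numeral_3_eq_3)
  qed
  have Ric: "Ric v w = \<eta> (R \<xi> v w) + g (R e1 v w) e1 / g e1 e1 + g (R e2 v w) e2 / g e2 e2" for v w
    unfolding Ric_def using tr[OF linear_R1] .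
  define k where "k = g (R e1 e2 e2) e1"
  \<comment> \<open>Skew symmetry moves \<xi> into the third slot of the curvature, where
    \<open>R_xi\<close> evaluates it.\<close>
  have eta_R: "\<eta> (R \<xi> v w) = - \<epsilon> * g v w" if "\<eta> v = 0" "\<eta> w = 0" for v w
  proof -
    have "\<epsilon> * \<eta> (R \<xi> v w) = g (R \<xi> v w) \<xi>" by (simp add: g_xi')
    also have "\<dots> = - g (R \<xi> v \<xi>) w" by (rule R_skew')
    also have "\<dots> = - g v w" by (simp add: R_xi eta_simps that)
    finally have "\<epsilon> * (\<epsilon> * \<eta> (R \<xi> v w)) = \<epsilon> * - g v w" by (rule arg_cong)
    then show ?thesis by (simp add: eps_sq mult.assoc[symmetric])
  qed
  have k1: "g (R e2 e1 e1) e2 = k"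
    using R_antisym[of e1 e2 e1] R_skew'[of e1 e2 e1 e2] by (simp add: k_def g_simps)
  have k2: "g (R e1 e2 e1) e2 = - k" using R_skew'[of e1 e2 e1 e2] by (simp add: k_def)
  \<comment> \<open>The sectional curvature of the kernel plane.\<close>
  define \<kappa> where "\<kappa> = k / (g e1 e1 * g e2 e2)"
  have S11: "Ric e1 e1 = (\<kappa> - \<epsilon>) * g e1 e1"
    using e by (simp add: Ric R_same g_simps k1 eta_R \<kappa>_def field_simps)
  have S22: "Ric e2 e2 = (\<kappa> - \<epsilon>) * g e2 e2"
    using e by (simp add: Ric R_same g_simps eta_R \<kappa>_def k_def[symmetric] field_simps)
  have S12: "Ric e1 e2 = 0" using e by (simp add: Ric R_same g_simps eta_R R_skew)
  have S21: "Ric e2 e1 = 0" using e e21 by (simp add: Ric R_same g_simps eta_R R_skew)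
  have Sxx: "Ric \<xi> \<xi> = - 2"
    using e by (simp add: Ric R_same R_xi g_simps eta_simps)
  have "scal = \<eta> (Ric_op \<xi>) + Ric e1 e1 / g e1 e1 + Ric e2 e2 / g e2 e2"
    unfolding scal_def by (simp add: tr[OF linear_Ric_op] Ric_op)
  moreover have "\<eta> (Ric_op \<xi>) = - 2 * \<epsilon>"
  proof -
    have "\<epsilon> * (\<epsilon> * \<eta> (Ric_op \<xi>)) = \<epsilon> * Ric \<xi> \<xi>" using Ric_op[of \<xi> \<xi>] by (simp add: g_xi')
    then show ?thesis by (simp add: Sxx eps_sq mult.assoc[symmetric])
  qed
  \<comment> \<open>Each of the two kernel directions contributes \<kappa> - \<epsilon> to the
    trace, and \<xi> contributes -2\<epsilon>.\<close>
  ultimately have "scal = 2 * \<kappa> - 4 * \<epsilon>" using e by (simp add: S11 S22)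
  then have scal: "\<kappa> = scal / 2 + 2 * \<epsilon>" by (simp add: field_simps)
  have expand: "\<exists>a b. v = a *\<^sub>R e1 + b *\<^sub>R e2" if "\<eta> v = 0" for v
    using exp[of v] that by auto
  show "Ric v w = (scal / 2 + \<epsilon>) * g v w" if 0: "\<eta> v = 0" "\<eta> w = 0"
  proof -
    obtain a b c d where v: "v = a *\<^sub>R e1 + b *\<^sub>R e2" and w: "w = c *\<^sub>R e1 + d *\<^sub>R e2"
      using expand[OF 0(1)] expand[OF 0(2)] by blast
    have "Ric v w = (\<kappa> - \<epsilon>) * g v w"
      unfolding v w
      by (simp add: bilinear_ladd[OF bilinear_Ric] bilinear_radd[OF bilinear_Ric]
          bilinear_lmul[OF bilinear_Ric] bilinear_rmul[OF bilinear_Ric] S11 S12 S21 S22 g_simps e e21 algebra_simps)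
    then show ?thesis by (simp add: scal)
  qed
  show "g (R u v v) u = (scal / 2 + 2 * \<epsilon>) * (g u u * g v v - (g u v)\<^sup>2)" if 0: "\<eta> u = 0" "\<eta> v = 0"
  proof -
    obtain a b c d where u: "u = a *\<^sub>R e1 + b *\<^sub>R e2" and v: "v = c *\<^sub>R e1 + d *\<^sub>R e2"
      using expand[OF 0(1)] expand[OF 0(2)] by blast
    \<comment> \<open>Both this expression and the Gram determinant below scale by the squared
      determinant of the change from e1, e2 to u, v.\<close>
    have "g (R u v v) u = (a * d - b * c)\<^sup>2 * k"
      unfolding u v
      by (simp add: R_simps g_simps R_same R_skew k1 k2 k_def[symmetric] R_antisym[of e2 e1 e2]
          power2_eq_square algebra_simps)
    moreover have "g u u * g v v - (g u v)\<^sup>2 = (a * d - b * c)\<^sup>2 * (g e1 e1 * g e2 e2)"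
      unfolding u v by (simp add: g_simps e e21 power2_eq_square algebra_simps)
    ultimately show ?thesis using e by (simp add: scal[symmetric] \<kappa>_def)
  qed
qed

end

section \<open>Connections and their curvature\<close>

context smooth_manifold
begin

text \<open>Provides the neighbourhood on which a quotient formula with denominator \<open>f\<close>
  is valid.\<close>

lemma open_nonzero:
  assumes "smooth_fun A f" shows "open {q. f q \<noteq> 0}"
proof -
  have "continuous_on (fst c) f" if "c \<in> A" for c
  proof -
    have "continuous_on (snd c ` fst c) (f \<circ> chart_inv c)" using smooth_funD[OF assms that, of 0] by simp
    moreover have "continuous_on (fst c) (snd c)" using chart_homeomorphism[OF that] by (simp add: homeomorphism_def)
    ultimately have "continuous_on (fst c) ((f \<circ> chart_inv c) \<circ> snd c)" by (rule continuous_on_compose[rotated])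
    then show ?thesis
      using continuous_on_cong[of "fst c" "fst c" "(f \<circ> chart_inv c) \<circ> snd c" f] chart_inv_snd[OF that] by simp
  qed
  then have "continuous_on (\<Union>c\<in>A. fst c) f"
    using chart_open by (intro continuous_on_open_UN) auto
  then have "continuous_on UNIV f" using atlas by (simp add: smooth_atlas_def)
  then show ?thesis using open_Collect_neq continuous_on_const by blast
qed

text \<open>The derivative vanishes on a coordinate ball, which is convex, so \<open>f\<close> is
  constant on its preimage. Local constancy then passes to every connected set.\<close>

lemma constant_on_connected:
  fixes f :: "'m \<Rightarrow> 'b::real_normed_vector"
  assumes f: "\<And>p. has_deriv_at A p f (\<lambda>v. 0)" and C: "connected C"
  shows "f constant_on C"
proof -
  have "eventually (\<lambda>q. f p = f q) (at p within C)" for p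
  proof -
    define c where "c = chart_at A p"
    have c: "c \<in> A" "p \<in> fst c" unfolding c_def by (rule chart_at_mem)+
    obtain e where e: "e > 0" "ball (snd c p) e \<subseteq> snd c ` fst c"
      using openE[OF chart_open(2)[OF c(1)]] c(2) by blast
    have "((f \<circ> chart_inv c) has_derivative (\<lambda>v. 0)) (at y within ball (snd c p) e)"
      if y: "y \<in> ball (snd c p) e" for y
    proof -
      obtain q where q: "q \<in> fst c" "y = snd c q" using e(2) y by blast
      show ?thesis
        using has_derivative_chart[OF c(1) q(1) f] q(2) by (simp add: has_derivative_at_withinI)
    qed
    then obtain a where a: "\<And>y. y \<in> ball (snd c p) e \<Longrightarrow> (f \<circ> chart_inv c) y = a"
      using has_derivative_zero_constant[OF convex_ball] by metis
    have cont: "continuous_on (fst c) (snd c)"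
      using chart_homeomorphism[OF c(1)] by (simp add: homeomorphism_def)
    define U where "U = fst c \<inter> snd c -` ball (snd c p) e"
    have "open U" unfolding U_def
      by (rule continuous_open_preimage[OF cont chart_open(1)[OF c(1)] open_ball])
    moreover have "p \<in> U" using c e(1) by (simp add: U_def)
    moreover have "f q = a" if "q \<in> U" for q
      using that a[of "snd c q"] chart_inv_snd[OF c(1)] by (simp add: U_def)
    ultimately show ?thesis unfolding eventually_at_topological by metis
  qed
  then show ?thesis
    unfolding constant_on_def using connected_local_const[OF C] by metis
qed

end

locale torsion_free_connection = smooth_manifold A
  for A :: "('m::{t2_space, second_countable_topology}, 'n::finite) chart set" +
  fixes nabla :: "('m \<Rightarrow> real ^ 'n) \<Rightarrow> ('m \<Rightarrow> real ^ 'n) \<Rightarrow> 'm \<Rightarrow> real ^ 'n"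
  assumes connection: "connection A nabla"
    and torsion_free: "X \<in> vector_fields A \<Longrightarrow> Y \<in> vector_fields A \<Longrightarrow>
      nabla X Y p - nabla Y X p = lie_bracket A X Y p"
begin

abbreviation "VF \<equiv> vector_fields A"
abbreviation "Rm \<equiv> curvature A nabla"

section \<open>Tensoriality and symmetries of the curvature\<close>

lemma nabla_mem: "X \<in> VF \<Longrightarrow> Y \<in> VF \<Longrightarrow> nabla X Y \<in> VF"
  using connection unfolding connection_def by blast

lemma nabla_add_left: "X \<in> VF \<Longrightarrow> Y \<in> VF \<Longrightarrow> Z \<in> VF \<Longrightarrow>
    nabla (\<lambda>p. X p + Y p) Z = (\<lambda>p. nabla X Z p + nabla Y Z p)"
  using connection unfolding connection_def by blast

lemma nabla_add_right: "X \<in> VF \<Longrightarrow> Y \<in> VF \<Longrightarrow> Z \<in> VF \<Longrightarrow>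
    nabla X (\<lambda>p. Y p + Z p) = (\<lambda>p. nabla X Y p + nabla X Z p)"
  using connection unfolding connection_def by blast

lemma nabla_scaleR_left: "smooth_fun A f \<Longrightarrow> X \<in> VF \<Longrightarrow> Y \<in> VF \<Longrightarrow>
    nabla (\<lambda>p. f p *\<^sub>R X p) Y = (\<lambda>p. f p *\<^sub>R nabla X Y p)"
  using connection unfolding connection_def by blast

lemma nabla_scaleR_right: "smooth_fun A f \<Longrightarrow> X \<in> VF \<Longrightarrow> Y \<in> VF \<Longrightarrow>
    nabla X (\<lambda>p. f p *\<^sub>R Y p) = (\<lambda>p. deriv_along A X f p *\<^sub>R Y p + f p *\<^sub>R nabla X Y p)"
  using connection unfolding connection_def by blast

lemma nabla_cmul_right: "X \<in> VF \<Longrightarrow> Y \<in> VF \<Longrightarrow> nabla X (\<lambda>p. a *\<^sub>R Y p) = (\<lambda>p. a *\<^sub>R nabla X Y p)"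
  using nabla_scaleR_right[OF smooth_fun_const] by (simp add: deriv_along_const)

lemma nabla_zero_right: "X \<in> VF \<Longrightarrow> nabla X (\<lambda>p. 0) = (\<lambda>p. 0)"
  using nabla_cmul_right[of X "\<lambda>p. 0" 0] vector_fields_0 by simp

lemma lie_bracket_eq: "X \<in> VF \<Longrightarrow> Y \<in> VF \<Longrightarrow> lie_bracket A X Y = (\<lambda>p. nabla X Y p - nabla Y X p)"
  using torsion_free by force

lemma lie_bracket_mem: "X \<in> VF \<Longrightarrow> Y \<in> VF \<Longrightarrow> lie_bracket A X Y \<in> VF"
  by (simp add: lie_bracket_eq vector_fields_diff nabla_mem)

lemma curvature_mem: "X \<in> VF \<Longrightarrow> Y \<in> VF \<Longrightarrow> Z \<in> VF \<Longrightarrow> Rm X Y Z \<in> VF"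
  unfolding curvature_def[abs_def] by (intro vector_fields_diff nabla_mem lie_bracket_mem)

lemma curvature_antisym:
  assumes "X \<in> VF" "Y \<in> VF" "Z \<in> VF"
  shows "Rm Y X Z p = - Rm X Y Z p"
proof -
  have "lie_bracket A Y X = (\<lambda>p. (- 1) *\<^sub>R lie_bracket A X Y p)"
    using assms by (simp add: lie_bracket_eq)
  then have "nabla (lie_bracket A Y X) Z p = - nabla (lie_bracket A X Y) Z p"
    using nabla_scaleR_left[OF smooth_fun_const[of "- 1"] lie_bracket_mem[OF assms(1,2)] assms(3)] by simp
  then show ?thesis by (simp add: curvature_def)
qed

lemma curvature_add1:
  assumes "X \<in> VF" "X' \<in> VF" "Y \<in> VF" "Z \<in> VF"
  shows "Rm (\<lambda>p. X p + X' p) Y Z p = Rm X Y Z p + Rm X' Y Z p"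
proof -
  have "lie_bracket A (\<lambda>p. X p + X' p) Y = (\<lambda>p. lie_bracket A X Y p + lie_bracket A X' Y p)"
    using assms by (simp add: lie_bracket_eq vector_fields_add nabla_add_left nabla_add_right algebra_simps)
  then show ?thesis
    using assms by (simp add: curvature_def nabla_add_left nabla_add_right nabla_mem lie_bracket_mem)
qed

text \<open>From [fX, Y] = f[X, Y] - Y(f)X, the extra term of the bracket cancels the derivative of
  \<open>f\<close> that arises in \<nabla>_Y(f \<nabla>_X Z).\<close>

lemma curvature_scaleR1:
  assumes f: "smooth_fun A f" and "X \<in> VF" "Y \<in> VF" "Z \<in> VF"
  shows "Rm (\<lambda>p. f p *\<^sub>R X p) Y Z p = f p *\<^sub>R Rm X Y Z p"
proof -
  let ?Yf = "\<lambda>p. - deriv_along A Y f p"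
  have Yf: "smooth_fun A ?Yf" using f assms(3) smooth_fun_minus smooth_fun_deriv_along by blast
  have "lie_bracket A (\<lambda>p. f p *\<^sub>R X p) Y = (\<lambda>p. f p *\<^sub>R lie_bracket A X Y p + ?Yf p *\<^sub>R X p)"
    using assms by (simp add: lie_bracket_eq vector_fields_scaleR nabla_scaleR_left nabla_scaleR_right
        algebra_simps)
  then have "nabla (lie_bracket A (\<lambda>p. f p *\<^sub>R X p) Y) Z p =
      f p *\<^sub>R nabla (lie_bracket A X Y) Z p + ?Yf p *\<^sub>R nabla X Z p"
    using assms Yf by (simp only: nabla_add_left nabla_scaleR_left vector_fields_scaleR lie_bracket_mem)
  then show ?thesis
    using assms
    by (simp add: curvature_def nabla_scaleR_left nabla_scaleR_right nabla_mem scaleR_diff_right)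
qed

lemma curvature_add3:
  assumes "X \<in> VF" "Y \<in> VF" "Z \<in> VF" "Z' \<in> VF"
  shows "Rm X Y (\<lambda>p. Z p + Z' p) p = Rm X Y Z p + Rm X Y Z' p"
  using assms by (simp add: curvature_def nabla_add_right nabla_mem lie_bracket_mem)

text \<open>The first derivatives of \<open>f\<close> cancel in the commutator; the second
  derivatives leave X(Yf) - Y(Xf), which \<open>deriv_along_lie_bracket\<close> matches with the
  bracket term.\<close>

lemma curvature_scaleR3:
  assumes f: "smooth_fun A f" and XYZ: "X \<in> VF" "Y \<in> VF" "Z \<in> VF"
  shows "Rm X Y (\<lambda>p. f p *\<^sub>R Z p) p = f p *\<^sub>R Rm X Y Z p"
proof -
  have 2: "nabla U (nabla V (\<lambda>p. f p *\<^sub>R Z p)) p =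
      (deriv_along A U (deriv_along A V f) p *\<^sub>R Z p + deriv_along A V f p *\<^sub>R nabla U Z p) +
      (deriv_along A U f p *\<^sub>R nabla V Z p + f p *\<^sub>R nabla U (nabla V Z) p)"
    if "U \<in> VF" "V \<in> VF" for U V
    using that XYZ(3) f smooth_fun_deriv_along[OF that(2) f]
    by (simp add: nabla_scaleR_right nabla_add_right nabla_mem vector_fields_scaleR)
  show ?thesis
    unfolding curvature_def 2[OF XYZ(1,2)] 2[OF XYZ(2,1)]
      nabla_scaleR_right[OF f lie_bracket_mem[OF XYZ(1,2)] XYZ(3)] deriv_along_lie_bracket[OF XYZ(1,2) f]
    by (simp add: algebra_simps)
qed

lemma curvature_add2:
  assumes "X \<in> VF" "Y \<in> VF" "Y' \<in> VF" "Z \<in> VF"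
  shows "Rm X (\<lambda>p. Y p + Y' p) Z p = Rm X Y Z p + Rm X Y' Z p"
  using assms curvature_add1[of Y Y' X Z p]
  by (simp add: curvature_antisym[of _ X] vector_fields_add)

lemma curvature_scaleR2:
  assumes "smooth_fun A f" "X \<in> VF" "Y \<in> VF" "Z \<in> VF"
  shows "Rm X (\<lambda>p. f p *\<^sub>R Y p) Z p = f p *\<^sub>R Rm X Y Z p"
  using assms curvature_scaleR1[of f Y X Z p]
  by (simp add: curvature_antisym[of _ X] vector_fields_scaleR)

text \<open>The three fields are replaced one slot at a time by tensoriality, which makes the
  arbitrary extensions in \<open>curvature_at\<close> harmless.\<close>

lemma curvature_eq_at:
  assumes X: "X \<in> VF" and Y: "Y \<in> VF" and Z: "Z \<in> VF"
  shows "Rm X Y Z p = curvature_at A nabla p (X p) (Y p) (Z p)"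
proof -
  let ?X = "extend_vec A p (X p)" and ?Y = "extend_vec A p (Y p)" and ?Z = "extend_vec A p (Z p)"
  note e = extend_vec(1) and v = extend_vec(2)
  have "Rm X Y Z p = Rm ?X Y Z p"
    by (rule tensorial[where \<Phi> = "\<lambda>X. Rm X Y Z"])
      (simp_all add: curvature_add1 curvature_scaleR1 X Y Z e v)
  also have "\<dots> = Rm ?X ?Y Z p"
    by (rule tensorial[where \<Phi> = "\<lambda>Y. Rm ?X Y Z"])
      (simp_all add: curvature_add2 curvature_scaleR2 X Y Z e v)
  also have "\<dots> = Rm ?X ?Y ?Z p"
    by (rule tensorial[where \<Phi> = "\<lambda>Z. Rm ?X ?Y Z"])
      (simp_all add: curvature_add3 curvature_scaleR3 X Y Z e v)
  finally show ?thesis unfolding curvature_at_def .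
qed

lemma curvature_at_antisym: "curvature_at A nabla p v u w = - curvature_at A nabla p u v w"
  unfolding curvature_at_def using extend_vec(1) by (intro curvature_antisym) auto

lemma linear_curvature_at1: "linear (\<lambda>u. curvature_at A nabla p u v w)"
proof (rule linearI)
  note e = extend_vec(1) and v = extend_vec(2)
  fix u u' a
  show "curvature_at A nabla p (u + u') v w = curvature_at A nabla p u v w + curvature_at A nabla p u' v w"
    using curvature_add1[OF e[of p u] e[of p u'] e[of p v] e[of p w], of p]
    by (simp add: curvature_eq_at e v vector_fields_add)
  show "curvature_at A nabla p (a *\<^sub>R u) v w = a *\<^sub>R curvature_at A nabla p u v w"
    using curvature_scaleR1[OF smooth_fun_const[of a] e[of p u] e[of p v] e[of p w], of p]
    by (simp add: curvature_eq_at e v vector_fields_cmul)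
qed

lemma linear_curvature_at2: "linear (\<lambda>v. curvature_at A nabla p u v w)"
  using linear_compose_neg[OF linear_curvature_at1[of p u w]]
  by (simp add: curvature_at_antisym[of p _ u])

lemma linear_curvature_at3: "linear (curvature_at A nabla p u v)"
proof (rule linearI)
  note e = extend_vec(1) and v = extend_vec(2)
  fix w w' a
  show "curvature_at A nabla p u v (w + w') = curvature_at A nabla p u v w + curvature_at A nabla p u v w'"
    using curvature_add3[OF e[of p u] e[of p v] e[of p w] e[of p w'], of p]
    by (simp add: curvature_eq_at e v vector_fields_add)
  show "curvature_at A nabla p u v (a *\<^sub>R w) = a *\<^sub>R curvature_at A nabla p u v w"
    using curvature_scaleR3[OF smooth_fun_const[of a] e[of p u] e[of p v] e[of p w], of p]
    by (simp add: curvature_eq_at e v vector_fields_cmul)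
qed

text \<open>Applying \<open>[X, Y] = X Y - Y X\<close> to the function \<open>g(Z, Z)\<close>.\<close>

lemma curvature_skew:
  assumes g: "tensor_0_2 A g" and sym: "\<And>p u v. g p u v = g p v u"
    and compatible: "\<And>X Y Z p. X \<in> VF \<Longrightarrow> Y \<in> VF \<Longrightarrow> Z \<in> VF \<Longrightarrow>
      deriv_along A X (\<lambda>q. g q (Y q) (Z q)) p = g p (nabla X Y p) (Z p) + g p (Y p) (nabla X Z p)"
    and XYZ: "X \<in> VF" "Y \<in> VF" "Z \<in> VF"
  shows "g p (Rm X Y Z p) (Z p) = 0"
proof -
  define h where "h q = g q (Z q) (Z q)" for q
  have bil: "bilinear (g q)" for q using g unfolding tensor_0_2_def by blast
  have sg: "smooth_fun A (\<lambda>q. g q (U q) (V q))" if "U \<in> VF" "V \<in> VF" for U V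
    using g that unfolding tensor_0_2_def by blast
  have h: "smooth_fun A h" unfolding h_def using sg XYZ(3) by blast
  have 1: "deriv_along A U h = (\<lambda>q. 2 * g q (nabla U Z q) (Z q))" if "U \<in> VF" for U
  proof
    fix q show "deriv_along A U h q = 2 * g q (nabla U Z q) (Z q)"
      using compatible[OF that XYZ(3,3), of q] sym[of q "Z q"] by (simp add: h_def[abs_def])
  qed
  have 2: "deriv_along A U (deriv_along A V h) p =
      2 * (g p (nabla U (nabla V Z) p) (Z p) + g p (nabla V Z p) (nabla U Z p))"
    if "U \<in> VF" "V \<in> VF" for U V
  proof -
    have "deriv_along A U (\<lambda>q. 2 * g q (nabla V Z q) (Z q)) p = 2 * deriv_along A U (\<lambda>q. g q (nabla V Z q) (Z q)) p"
      using deriv_along_mult[OF smooth_fun_const[of 2] sg[OF nabla_mem[OF that(2) XYZ(3)] XYZ(3)]]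
      by (simp add: deriv_along_const)
    then show ?thesis
      using compatible[OF that(1) nabla_mem[OF that(2) XYZ(3)] XYZ(3), of p] by (simp add: 1[OF that(2)])
  qed
  \<comment> \<open>Both sides are [X, Y]h: the left by metric compatibility along the bracket, the
    right as a commutator, whose mixed products cancel by symmetry of \<open>g\<close>.\<close>
  have "2 * g p (nabla (lie_bracket A X Y) Z p) (Z p) =
      2 * (g p (nabla X (nabla Y Z) p) (Z p) + g p (nabla Y Z p) (nabla X Z p)) -
      2 * (g p (nabla Y (nabla X Z) p) (Z p) + g p (nabla X Z p) (nabla Y Z p))"
    using deriv_along_lie_bracket[OF XYZ(1,2) h, of p] 2[OF XYZ(1,2)] 2[OF XYZ(2,1)]
      1[OF lie_bracket_mem[OF XYZ(1,2)]] by simp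
  then show ?thesis
    using sym[of p "nabla X Z p" "nabla Y Z p"]
    by (simp add: curvature_def bilinear_lsub[OF bil])
qed

end

section \<open>The scalar curvature of a 3-dimensional \<open>\<epsilon>\<close>-para Sasakian manifold\<close>

locale para_sasakian_3 =
  fixes A :: "('m::{t2_space, second_countable_topology}, 3) chart set"
    and \<phi> :: "'m \<Rightarrow> real ^ 3 \<Rightarrow> real ^ 3"
    and \<xi> :: "'m \<Rightarrow> real ^ 3"
    and \<eta> :: "'m \<Rightarrow> real ^ 3 \<Rightarrow> real"
    and g :: "'m \<Rightarrow> real ^ 3 \<Rightarrow> real ^ 3 \<Rightarrow> real"
    and \<epsilon> :: real
    and nabla :: "('m \<Rightarrow> real ^ 3) \<Rightarrow> ('m \<Rightarrow> real ^ 3) \<Rightarrow> ('m \<Rightarrow> real ^ 3)"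
  assumes smooth: "smooth_atlas A"
    and para_sasakian: "eps_para_sasakian A \<phi> \<xi> \<eta> g \<epsilon> nabla"
begin

lemma metric_structure: "eps_almost_paracontact_metric A \<phi> \<xi> \<eta> g \<epsilon>"
  using para_sasakian unfolding eps_para_sasakian_def by blast

lemma paracontact: "almost_paracontact A \<phi> \<xi> \<eta>"
  using metric_structure unfolding eps_almost_paracontact_metric_def by blast

lemma metric: "semi_riemannian_metric A g"
  using metric_structure unfolding eps_almost_paracontact_metric_def by blast

lemma tensor_g: "tensor_0_2 A g" and g_sym: "g p u v = g p v u"
  using metric unfolding semi_riemannian_metric_def by blast+

lemma levi_civita: "levi_civita A g nabla"
  using para_sasakian unfolding eps_para_sasakian_def by blast

sublocale torsion_free_connection A nabla
  using smooth levi_civita unfolding levi_civita_def by unfold_locales blast+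

lemma xi_mem: "\<xi> \<in> VF" and phi_mem: "X \<in> VF \<Longrightarrow> (\<lambda>q. \<phi> q (X q)) \<in> VF"
  using paracontact unfolding almost_paracontact_def tensor_1_1_def by blast+

lemma smooth_g: "X \<in> VF \<Longrightarrow> Y \<in> VF \<Longrightarrow> smooth_fun A (\<lambda>q. g q (X q) (Y q))"
  using tensor_g unfolding tensor_0_2_def by blast

lemma compatible:
  "X \<in> VF \<Longrightarrow> Y \<in> VF \<Longrightarrow> Z \<in> VF \<Longrightarrow>
   deriv_along A X (\<lambda>q. g q (Y q) (Z q)) p = g p (nabla X Y p) (Z p) + g p (Y p) (nabla X Z p)"
  using levi_civita unfolding levi_civita_def by blast

sublocale tangent: paracontact_space "g p" "\<phi> p" "\<xi> p" "\<eta> p" \<epsilon> for p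
proof (rule paracontact_space.intro)
  show "bilinear (g p)" using tensor_g unfolding tensor_0_2_def by blast
  show "g p u v = g p v u" for u v by (rule g_sym)
  show "u = 0" if "\<And>v. g p u v = 0" for u
    using that metric unfolding semi_riemannian_metric_def by blast
  show "linear (\<phi> p)" "linear (\<eta> p)"
    using paracontact unfolding almost_paracontact_def tensor_1_1_def one_form_def by blast+
  show "\<epsilon> \<in> {1, - 1}" using metric_structure unfolding eps_almost_paracontact_metric_def by blast
  show "\<phi> p (\<phi> p v) = v - \<eta> p v *\<^sub>R \<xi> p" "\<eta> p (\<xi> p) = 1" "\<phi> p (\<xi> p) = 0" "\<eta> p (\<phi> p v) = 0" for v
    using paracontact unfolding almost_paracontact_def by blast+
  show "g p (\<phi> p u) (\<phi> p v) = g p u v - \<epsilon> * \<eta> p u * \<eta> p v" for u v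
  proof -
    have "g p (\<phi> p (extend_vec A p u p)) (\<phi> p (extend_vec A p v p)) =
        g p (extend_vec A p u p) (extend_vec A p v p) -
        \<epsilon> * \<eta> p (extend_vec A p u p) * \<eta> p (extend_vec A p v p)"
      using metric_structure extend_vec(1) unfolding eps_almost_paracontact_metric_def by blast
    then show ?thesis by (simp only: extend_vec(2))
  qed
qed

lemmas phi_simps = linear_cmul[OF tangent.linear_phi] linear_diff[OF tangent.linear_phi]
  tangent.phi_phi tangent.phi_xi tangent.eta_phi

section \<open>The characteristic vector field and its curvature\<close>

lemma nabla_phi:
  assumes "X \<in> VF" "Y \<in> VF"
  shows "nabla X (\<lambda>q. \<phi> q (Y q)) p = \<phi> p (nabla X Y p)
    - g p (\<phi> p (X p)) (\<phi> p (Y p)) *\<^sub>R \<xi> p - (\<epsilon> * \<eta> p (Y p)) *\<^sub>R \<phi> p (\<phi> p (X p))"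
proof -
  have "cov_deriv_1_1 nabla \<phi> X Y p =
      - g p (\<phi> p (X p)) (\<phi> p (Y p)) *\<^sub>R \<xi> p - (\<epsilon> * \<eta> p (Y p)) *\<^sub>R \<phi> p (\<phi> p (X p))"
    using para_sasakian assms unfolding eps_para_sasakian_def by blast
  then show ?thesis by (simp add: cov_deriv_1_1_def algebra_simps)
qed

text \<open>Differentiating \<phi>\<xi> = 0 gives \<phi>(\<nabla>_X \<xi>) = \<epsilon> \<phi>^2 X.
  Another \<phi> recovers \<nabla>_X \<xi>, whose \<eta>-component vanishes because g(\<xi>, \<xi>)
  = \<epsilon> is constant.\<close>

lemma nabla_xi:
  assumes X: "X \<in> VF"
  shows "nabla X \<xi> p = \<epsilon> *\<^sub>R \<phi> p (X p)"
proof -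
  have "deriv_along A X (\<lambda>q. g q (\<xi> q) (\<xi> q)) p = 0"
    by (simp add: tangent.g_xi tangent.eta_xi deriv_along_const)
  then have "\<epsilon> * \<eta> p (nabla X \<xi> p) = 0"
    using compatible[OF X xi_mem xi_mem, of p] by (simp add: tangent.g_xi tangent.g_xi')
  then have eta: "\<eta> p (nabla X \<xi> p) = 0" using tangent.eps by auto
  have "\<phi> p (nabla X \<xi> p) = \<epsilon> *\<^sub>R \<phi> p (\<phi> p (X p))"
    using nabla_phi[OF X xi_mem, of p]
    by (simp add: tangent.phi_xi tangent.eta_xi nabla_zero_right[OF X] tangent.g_simps)
  then have "\<phi> p (\<phi> p (nabla X \<xi> p)) = \<phi> p (\<epsilon> *\<^sub>R \<phi> p (\<phi> p (X p)))" by (rule arg_cong)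
  then show ?thesis by (simp add: eta phi_simps)
qed

text \<open>Insert \<nabla>\<xi> = \<epsilon>\<phi> twice. The terms \<phi>(\<nabla>_X Y) cancel
  against the bracket since the torsion is zero, the metric terms cancel by symmetry, and
  \<epsilon>^2 = 1.\<close>

lemma curvature_xi:
  assumes X: "X \<in> VF" and Y: "Y \<in> VF"
  shows "Rm X Y \<xi> p = \<eta> p (X p) *\<^sub>R Y p - \<eta> p (Y p) *\<^sub>R X p"
proof -
  have 2: "nabla U (nabla V \<xi>) p = \<epsilon> *\<^sub>R (\<phi> p (nabla U V p)
      - g p (\<phi> p (U p)) (\<phi> p (V p)) *\<^sub>R \<xi> p - (\<epsilon> * \<eta> p (V p)) *\<^sub>R \<phi> p (\<phi> p (U p)))"
    if "U \<in> VF" "V \<in> VF" for U V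
  proof -
    have "nabla V \<xi> = (\<lambda>q. \<epsilon> *\<^sub>R \<phi> q (V q))" using nabla_xi[OF that(2)] by blast
    then show ?thesis
      using that by (simp add: nabla_cmul_right phi_mem nabla_phi)
  qed
  have "nabla (lie_bracket A X Y) \<xi> p = \<epsilon> *\<^sub>R (\<phi> p (nabla X Y p) - \<phi> p (nabla Y X p))"
    unfolding nabla_xi[OF lie_bracket_mem[OF X Y]] by (simp add: phi_simps lie_bracket_eq X Y)
  then have "Rm X Y \<xi> p = (\<epsilon> * \<epsilon>) *\<^sub>R (\<eta> p (X p) *\<^sub>R \<phi> p (\<phi> p (Y p)) - \<eta> p (Y p) *\<^sub>R \<phi> p (\<phi> p (X p)))"
    using g_sym[of p "\<phi> p (X p)" "\<phi> p (Y p)"]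
    by (simp add: curvature_def 2[OF X Y] 2[OF Y X] algebra_simps)
  then show ?thesis by (simp add: tangent.eps_sq phi_simps algebra_simps)
qed

sublocale tangent: paracontact_curvature "g p" "\<phi> p" "\<xi> p" "\<eta> p" \<epsilon> "curvature_at A nabla p" for p
proof (intro paracontact_curvature.intro paracontact_curvature_axioms.intro tangent.paracontact_space_axioms)
  show "linear (\<lambda>u. curvature_at A nabla p u v w)" "linear (\<lambda>v. curvature_at A nabla p u v w)"
    "linear (curvature_at A nabla p u v)" for u v w
    by (rule linear_curvature_at1 linear_curvature_at2 linear_curvature_at3)+
  show "curvature_at A nabla p v u w = - curvature_at A nabla p u v w" for u v w
    by (rule curvature_at_antisym)
  show "g p (curvature_at A nabla p u v w) w = 0" for u v w
  proof -
    have "g p (Rm (extend_vec A p u) (extend_vec A p v) (extend_vec A p w) p) (extend_vec A p w p) = 0"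
      by (rule curvature_skew[OF tensor_g]) (rule g_sym compatible extend_vec(1) | assumption)+
    then show ?thesis by (simp only: curvature_at_def extend_vec(2))
  qed
  show "curvature_at A nabla p u v (\<xi> p) = \<eta> p u *\<^sub>R v - \<eta> p v *\<^sub>R u" for u v
    using curvature_xi[OF extend_vec(1)[of p u] extend_vec(1)[of p v], of p]
    by (simp add: curvature_eq_at extend_vec xi_mem)
qed

abbreviation "r \<equiv> scalar_curvature A g nabla"

lemma Ric_eq: "tangent.Ric p = ricci A nabla p"
  by (intro ext) (simp add: tangent.Ric_def ricci_def)

lemma scal_eq: "tangent.scal p = r p"
proof -
  have "tangent.Ric_op p = ricci_op A g nabla p"
    by (intro ext) (simp add: tangent.Ric_op_def ricci_op_def Ric_eq)
  then show ?thesis by (simp add: tangent.scal_def scalar_curvature_def)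
qed

section \<open>Differentiating the scalar curvature\<close>

lemma ricci_on_kernel:
  "\<eta> p v = 0 \<Longrightarrow> \<eta> p w = 0 \<Longrightarrow> ricci A nabla p v w = (r p / 2 + \<epsilon>) * g p v w"
  using tangent.Ric_on_kernel by (simp add: Ric_eq scal_eq)

lemma curvature_on_kernel:
  assumes "U \<in> VF" "V \<in> VF" "\<eta> p (U p) = 0" "\<eta> p (V p) = 0"
  shows "g p (Rm U V V p) (U p) =
    (r p / 2 + 2 * \<epsilon>) * (g p (U p) (U p) * g p (V p) (V p) - (g p (U p) (V p))\<^sup>2)"
  using tangent.R_on_kernel[OF assms(3,4)] assms(1,2) by (simp add: curvature_eq_at scal_eq)

text \<open>\<phi>^2 is the projection onto the kernel of \<eta> along \<xi>. In this form the field
  is visibly \<phi> of a vector field, as the \<eta>-parallel condition demands of its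
  arguments.\<close>

definition kernel_field :: "'m \<Rightarrow> real ^ 3 \<Rightarrow> 'm \<Rightarrow> real ^ 3" where
  "kernel_field p e q = \<phi> q (\<phi> q (extend_vec A p e q))"

lemma kernel_field_mem: "kernel_field p e \<in> VF"
  unfolding kernel_field_def[abs_def] by (intro phi_mem extend_vec)

lemma eta_kernel_field: "\<eta> q (kernel_field p e q) = 0"
  by (simp add: kernel_field_def tangent.eta_phi)

lemma kernel_field_at: "\<eta> p e = 0 \<Longrightarrow> kernel_field p e p = e"
  by (simp add: kernel_field_def extend_vec tangent.phi_phi)

text \<open>Near \<open>p\<close> the scalar curvature is a quotient of smooth functions by \<open>curvature_on_kernel\<close>.
  This matters since \<open>deriv_along\<close> has no meaning for functions that are not differentiable.\<close>

lemma scalar_curvature_has_deriv_at: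
  "has_deriv_at A p r (\<lambda>v. deriv_at A p v r)"
proof -
  obtain e1 e2 where e: "\<eta> p e1 = 0" "\<eta> p e2 = 0" "g p e1 e2 = 0" "g p e1 e1 \<noteq> 0" "g p e2 e2 \<noteq> 0"
    using tangent.orthogonal_frame by blast
  define U V where "U = kernel_field p e1" and "V = kernel_field p e2"
  have UV: "U \<in> VF" "V \<in> VF" "\<And>q. \<eta> q (U q) = 0" "\<And>q. \<eta> q (V q) = 0" "U p = e1" "V p = e2"
    using kernel_field_mem eta_kernel_field kernel_field_at e by (auto simp: U_def V_def)
  define N where "N q = g q (Rm U V V q) (U q)" for q
  \<comment> \<open>The Gram determinant of \<open>U\<close> and \<open>V\<close>, nonzero at
    \<open>p\<close> because e1 and e2 are orthogonal and nonnull.\<close>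
  define D where "D q = g q (U q) (U q) * g q (V q) (V q) - g q (U q) (V q) * g q (U q) (V q)" for q
  have N: "smooth_fun A N" unfolding N_def using UV by (intro smooth_g curvature_mem)
  have D: "smooth_fun A D" unfolding D_def using UV by (intro smooth_fun_diff smooth_fun_mult smooth_g)
  have Dp: "D p \<noteq> 0" using e UV by (simp add: D_def)
  \<comment> \<open>\<open>curvature_on_kernel\<close> solved for the scalar curvature.\<close>
  have rq: "(- 4 * \<epsilon>) + 2 * (N q / D q) = r q" if "q \<in> {q. D q \<noteq> 0}" for q
    using curvature_on_kernel[OF UV(1-4), of q] that by (simp add: N_def D_def power2_eq_square field_simps)
  obtain d where d: "has_deriv_at A p (\<lambda>q. N q / D q) d"
    using has_deriv_at_divide[OF smooth_fun_has_deriv_at[OF N] smooth_fun_has_deriv_at[OF D] Dp] .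
  have "has_deriv_at A p (\<lambda>q. (- 4 * \<epsilon>) + 2 * (N q / D q)) (\<lambda>v. 0 + (2 * d v + 0 * (N p / D p)))"
    by (rule has_deriv_at_add[OF has_deriv_at_const has_deriv_at_mult[OF has_deriv_at_const d]])
  then have "has_deriv_at A p r (\<lambda>v. 0 + (2 * d v + 0 * (N p / D p)))"
    by (rule has_deriv_at_cong[OF _ open_nonzero[OF D] _ rq]) (use Dp in auto)
  then show ?thesis using deriv_at_eq by (metis (no_types, lifting) ext)
qed

text \<open>Differentiate g(E, \<xi>) = 0 along \<open>X\<close> for the kernel field E: since
  \<nabla>_X \<xi> = \<epsilon> \<phi> X, the result is \<eta>(\<nabla>_X E) = - g(e, \<phi>
  X).\<close>

lemma eta_nabla_kernel_field:
  assumes X: "X \<in> VF" and e: "\<eta> p e = 0" and orth: "g p e (\<phi> p (X p)) = 0"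
  shows "\<eta> p (nabla X (kernel_field p e) p) = 0"
proof -
  have "deriv_along A X (\<lambda>q. g q (kernel_field p e q) (\<xi> q)) p = 0"
    by (simp add: tangent.g_xi' eta_kernel_field deriv_along_const)
  then have "\<epsilon> * \<eta> p (nabla X (kernel_field p e) p) = 0"
    using compatible[OF X kernel_field_mem xi_mem, of p e p] orth
    by (simp add: nabla_xi[OF X] tangent.g_xi' tangent.g_simps kernel_field_at[OF e])
  then show ?thesis using tangent.eps by auto
qed

text \<open>With h = g(F, F), the identity S(F, F) = (r/2 + \<epsilon>) h holds everywhere. At
  \<open>p\<close> the correction terms of the covariant derivative amount to (r/2 + \<epsilon>)
  X(h), so the product rule leaves X(r) h(p) = 0.\<close>

lemma deriv_scalar_curvature_aux:
  assumes parallel: "eta_parallel_ricci A \<phi> nabla"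
    and e: "\<eta> p e = 0" "g p e e \<noteq> 0" and orth: "g p e (\<phi> p u) = 0"
  shows "deriv_at A p u r = 0"
proof -
  define X where "X = extend_vec A p u"
  define F where "F = kernel_field p e"
  have X: "X \<in> VF" "X p = u" by (simp_all add: X_def extend_vec)
  have F: "F \<in> VF" "F p = e" "\<And>q. \<eta> q (F q) = 0"
    using kernel_field_mem kernel_field_at[OF e(1)] eta_kernel_field by (simp_all add: F_def)
  have nF: "\<eta> p (nabla X F p) = 0" using eta_nabla_kernel_field[OF X(1) e(1)] orth X(2) by (simp add: F_def)
  define h where "h q = g q (F q) (F q)" for q
  have h: "smooth_fun A h" unfolding h_def using F smooth_g by blast
  have dh: "deriv_along A X h p = 2 * g p (nabla X F p) e"
    using compatible[OF X(1) F(1,1), of p] g_sym[of p e] F(2) by (simp add: h_def[abs_def])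
  have "cov_deriv_0_2 A nabla (ricci A nabla) X F F p = 0"
    using parallel[unfolded eta_parallel_ricci_def, rule_format, OF X(1) phi_mem phi_mem,
        OF extend_vec(1) extend_vec(1), of p e p e p]
    by (simp add: F_def kernel_field_def[abs_def])
  then have "deriv_along A X (\<lambda>q. (r q / 2 + \<epsilon>) * h q) p = (r p / 2 + \<epsilon>) * deriv_along A X h p"
    using F nF e(1) g_sym[of p e]
    by (simp add: cov_deriv_0_2_def ricci_on_kernel h_def dh algebra_simps)
  moreover have "has_deriv_at A p (\<lambda>q. (1 / 2 * r q + \<epsilon>) * h q) (\<lambda>v. (1 / 2 * r p + \<epsilon>) * deriv_at A p v h +
      ((1 / 2 * deriv_at A p v r + 0 * r p) + 0) * h p)"
    by (intro has_deriv_at_mult has_deriv_at_add has_deriv_at_const scalar_curvature_has_deriv_at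
        smooth_fun_has_deriv_at h)
  ultimately have "deriv_at A p u r * h p = 0"
    using deriv_at_eq X(2) by (fastforce simp: deriv_along_def)
  then show ?thesis using e F(2) by (simp add: h_def)
qed

lemma deriv_scalar_curvature:
  assumes parallel: "eta_parallel_ricci A \<phi> nabla"
  shows "deriv_at A p v r = 0"
proof -
  obtain e1 e2 where e: "\<eta> p e1 = 0" "\<eta> p e2 = 0" "g p e1 e2 = 0" "g p e1 e1 \<noteq> 0" "g p e2 e2 \<noteq> 0"
    and exp: "\<And>u. u = \<eta> p u *\<^sub>R \<xi> p + (g p u e1 / g p e1 e1) *\<^sub>R e1 + (g p u e2 / g p e2 e2) *\<^sub>R e2"
    using tangent.orthogonal_frame by blast
  have l: "linear (\<lambda>v. deriv_at A p v r)"
    using scalar_curvature_has_deriv_at has_derivative_linear unfolding has_deriv_at_def by blast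
  have 0: "deriv_at A p (\<xi> p) r = 0"
    by (rule deriv_scalar_curvature_aux[OF parallel e(1,4)]) (simp add: tangent.phi_xi tangent.g_simps)
  \<comment> \<open>Here e2 serves as the nonnull vector, since \<phi>(\<phi> e1) = e1 is orthogonal
    to it; for \<phi> e2 the roles are exchanged.\<close>
  have 1: "deriv_at A p (\<phi> p e1) r = 0"
    by (rule deriv_scalar_curvature_aux[OF parallel e(2,5)])
      (simp add: tangent.phi_phi tangent.g_simps e g_sym[of p e2])
  have 2: "deriv_at A p (\<phi> p e2) r = 0"
    by (rule deriv_scalar_curvature_aux[OF parallel e(1,4)]) (simp add: tangent.phi_phi tangent.g_simps e)
  define a b where "a = g p (\<phi> p v) e1 / g p e1 e1" and "b = g p (\<phi> p v) e2 / g p e2 e2"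
  have "\<phi> p v = a *\<^sub>R e1 + b *\<^sub>R e2"
    using exp[of "\<phi> p v"] by (simp add: a_def b_def tangent.eta_phi)
  then have "\<phi> p (\<phi> p v) = a *\<^sub>R \<phi> p e1 + b *\<^sub>R \<phi> p e2"
    by (simp only: linear_add[OF tangent.linear_phi] linear_cmul[OF tangent.linear_phi])
  \<comment> \<open>Splitting v = \<eta>(v)\<xi> + \<phi>(\<phi> v) shows that the three directions
    treated above span the tangent space.\<close>
  then have "v = \<eta> p v *\<^sub>R \<xi> p + a *\<^sub>R \<phi> p e1 + b *\<^sub>R \<phi> p e2"
    by (simp add: tangent.phi_phi algebra_simps)
  then have "deriv_at A p v r = deriv_at A p (\<eta> p v *\<^sub>R \<xi> p + a *\<^sub>R \<phi> p e1 + b *\<^sub>R \<phi> p e2) r"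
    by (rule arg_cong)
  also have "\<dots> = 0" by (simp add: linear_add[OF l] linear_cmul[OF l] 0 1 2)
  finally show ?thesis .
qed

end

theorem proposition5p2:
  fixes A :: "('m::{t2_space, second_countable_topology}, 3) chart set"
    and \<phi> :: "'m \<Rightarrow> real ^ 3 \<Rightarrow> real ^ 3"
    and \<xi> :: "'m \<Rightarrow> real ^ 3"
    and \<eta> :: "'m \<Rightarrow> real ^ 3 \<Rightarrow> real"
    and g :: "'m \<Rightarrow> real ^ 3 \<Rightarrow> real ^ 3 \<Rightarrow> real"
    and \<epsilon> :: real
    and nabla :: "('m \<Rightarrow> real ^ 3) \<Rightarrow> ('m \<Rightarrow> real ^ 3) \<Rightarrow> ('m \<Rightarrow> real ^ 3)"
  assumes "smooth_atlas A"
    and "eps_para_sasakian A \<phi> \<xi> \<eta> g \<epsilon> nabla"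
    and "eta_parallel_ricci A \<phi> nabla"
  shows "\<forall>C. connected C \<longrightarrow> scalar_curvature A g nabla constant_on C"
proof (intro allI impI)
  fix C :: "'m set" assume C: "connected C"
  interpret para_sasakian_3 A \<phi> \<xi> \<eta> g \<epsilon> nabla
    using assms(1,2) by unfold_locales
  have "has_deriv_at A p r (\<lambda>v. 0)" for p
    using scalar_curvature_has_deriv_at[of p] by (simp add: deriv_scalar_curvature[OF assms(3)])
  then show "r constant_on C" using C by (rule constant_on_connected)
qed

end
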